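(* Let $0\le f\in L^1[-\pi,\pi]$ (not a.e. zero) and let $f^\#$ be its symmetric decreasing rearrangement. Then \[\int_{-\pi}^{\pi}\phi\bigl(u_f(x)\bigr)\,dx\le\int_{-\pi}^{\pi}\phi\bigl(u_{f^\#}(x)\bigr)\,dx\] for every convex and increasing $\phi:\mathbb{R}\to\mathbb{R}$; equivalently $u_f^\star(t)\le u_{f^\#}^\star(t)$ for all $t\in[0,2\pi]$. Furthermore, if $\phi$ is strictly increasing (and convex), equality holds if and only if $f=f^\#$ a.e. on $(-\pi,\pi)$.
   Context: $\lambda$ is Lebesgue measure. $G(x,y)=-\frac{xy}{2\pi}-\frac12|x-y|+\frac{\pi}{2}$ on $[-\pi,\pi]^2$, $u_g(x)=\int_{-\pi}^\pi G(x,y)g(y)\,dy$ (solution of $-u''=g$ on $(-\pi,\pi)$, $u(\pm\pi)=0$). Decreasing rearrangement: $f^*(t)=\inf\{s:\lambda(\{x\in[-\pi,\pi]:f(x)>s\})\le t\}$ for $t\in(0,2\pi)$, $f^*(0)=\operatorname{ess\,sup}f$, $f^*(2\pi)=\operatorname{ess\,inf}f$; $f^\#(t)=f^*(2|t|)$ on $[-\pi,\pi]$. Star function: $g^\star(t)=\sup\{\int_E g\,d\lambda:E\subset[-\pi,\pi]\text{ Borel},\lambda(E)=t\}$. *)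

theory Defs
  imports "HOL-Analysis.Analysis" "HOL-Probability.Essential_Supremum"
begin

text \<open>Green's function of -u'' = g on (-pi,pi) with Dirichlet conditions.\<close>
definition G :: "real \<Rightarrow> real \<Rightarrow> real" where
  "G x y = - (x * y) / (2 * pi) - \<bar>x - y\<bar> / 2 + pi / 2"

definition u :: "(real \<Rightarrow> real) \<Rightarrow> real \<Rightarrow> real" where
  "u g x = (LINT y:{-pi..pi}|lebesgue. G x y * g y)"

definition ess_sup_on :: "(real \<Rightarrow> real) \<Rightarrow> ereal" where
  "ess_sup_on f = esssup (restrict_space lebesgue {-pi..pi}) (\<lambda>x. ereal (f x))"

definition ess_inf_on :: "(real \<Rightarrow> real) \<Rightarrow> ereal" where
  "ess_inf_on f = - esssup (restrict_space lebesgue {-pi..pi}) (\<lambda>x. - ereal (f x))"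

definition decr_rearr :: "(real \<Rightarrow> real) \<Rightarrow> real \<Rightarrow> real" where
  "decr_rearr f t =
     (if t \<le> 0 then real_of_ereal (ess_sup_on f)
      else if t \<ge> 2 * pi then real_of_ereal (ess_inf_on f)
      else Inf {s. measure lebesgue {x \<in> {-pi..pi}. f x > s} \<le> t})"

definition sym_rearr :: "(real \<Rightarrow> real) \<Rightarrow> real \<Rightarrow> real" where
  "sym_rearr f t = decr_rearr f (2 * \<bar>t\<bar>)"

definition star_fun :: "(real \<Rightarrow> real) \<Rightarrow> real \<Rightarrow> real" where
  "star_fun g t = Sup {(LINT x:E|lebesgue. g x) | E.
       E \<in> sets borel \<and> E \<subseteq> {-pi..pi} \<and> measure lebesgue E = t}"

end

theory Submission
  imports Defs "HOL-Probability.Weak_Convergence"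
begin

text \<open>
  The comparison is pointwise. Let \<open>-pi \<le> a \<le> b \<le> pi\<close> and \<open>r = (b - a) / 2\<close>. A weighted mean of
  \<open>G a\<close> and \<open>G b\<close> is a trapezoid, and its symmetric decreasing rearrangement is \<open>skew a b \<le> 1\<close> times
  the trapezoid \<open>(G (- r) + G r) / 2\<close>. The Hardy-Littlewood inequality therefore gives
  \<open>min (u f a) (u f b) \<le> skew a b * v r\<close> with \<open>v = u (sym_rearr f)\<close>. Hence every superlevel set of
  \<open>u f\<close> is at most as long as the corresponding one of \<open>v\<close>, which yields both comparisons by the
  layer cake formula.

  If the integrals agree for a strictly increasing function, then \<open>skew a b = 1\<close>, that is \<open>a = - b\<close>,
  for the end points of almost every superlevel set. So \<open>u f\<close> equals \<open>v\<close>, and differentiating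
  \<open>u f = v\<close> recovers \<open>f\<close>.
\<close>

section \<open>Set integrals and the layer cake formula\<close>

lemma (in sigma_finite_measure) sigma_finite_measure_completion:
  "sigma_finite_measure (completion M)"
proof
  obtain A where "countable A" "A \<subseteq> sets M" "\<Union>A = space M" "\<forall>a\<in>A. emeasure M a \<noteq> \<infinity>"
    using sigma_finite_countable by blast
  then show "\<exists>A. countable A \<and> A \<subseteq> sets (completion M) \<and> \<Union>A = space (completion M)
      \<and> (\<forall>a\<in>A. emeasure (completion M) a \<noteq> \<infinity>)"
    by (intro exI[of _ A]) (auto simp: subset_eq)
qed

lemma (in sigma_finite_measure) set_nn_integral_mult_layer_cake:
  fixes f :: "'a \<Rightarrow> real"
  assumes f: "f \<in> borel_measurable (restrict_space M A)" and A: "A \<in> sets M"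
    and [measurable]: "k \<in> borel_measurable M"
  shows "(\<integral>\<^sup>+x\<in>A. k x * ennreal (f x) \<partial>M)
    = (\<integral>\<^sup>+s\<in>{0..}. (\<integral>\<^sup>+x\<in>{x\<in>A. s < f x}. k x \<partial>M) \<partial>lborel)"
proof -
  interpret product: pair_sigma_finite M lborel
    by (intro pair_sigma_finite.intro sigma_finite_measure_axioms sigma_finite_lborel)
  define g where "g = (\<lambda>x. indicator A x *\<^sub>R f x)"
  have [measurable]: "g \<in> borel_measurable M"
    unfolding g_def using f A by (subst (asm) borel_measurable_restrict_space_iff) auto
  have layers: "ennreal (g x) = (\<integral>\<^sup>+s. indicator {0..<g x} s \<partial>lborel)" for x
    by (cases "0 \<le> g x") (auto simp: ennreal_neg)
  have "(\<integral>\<^sup>+x\<in>A. k x * ennreal (f x) \<partial>M) = (\<integral>\<^sup>+x. k x * ennreal (g x) \<partial>M)"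
    by (intro nn_integral_cong) (auto simp: g_def indicator_def)
  also have "\<dots> = (\<integral>\<^sup>+x. (\<integral>\<^sup>+s. k x * (indicator {0..} s * indicator {x. s < g x} x) \<partial>lborel) \<partial>M)"
    unfolding layers by (subst nn_integral_cmult[symmetric])
      (auto intro!: nn_integral_cong simp: indicator_def)
  also have "\<dots> = (\<integral>\<^sup>+s. (\<integral>\<^sup>+x. k x * (indicator {0..} s * indicator {x. s < g x} x) \<partial>M) \<partial>lborel)"
    by (rule product.Fubini'[symmetric]) measurable
  also have "\<dots> = (\<integral>\<^sup>+s\<in>{0..}. (\<integral>\<^sup>+x\<in>{x\<in>A. s < f x}. k x \<partial>M) \<partial>lborel)"
    by (intro nn_integral_cong) (auto simp: g_def indicator_def intro!: nn_integral_cong)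
  finally show ?thesis .
qed

lemma superlevel_in_sets:
  fixes f :: "'a \<Rightarrow> real"
  assumes f: "f \<in> borel_measurable (restrict_space M A)" and A: "A \<in> sets M"
  shows "{x\<in>A. s < f x} \<in> sets M"
proof -
  have "{x\<in>space (restrict_space M A). s < f x} \<in> sets (restrict_space M A)"
    using f by measurable
  moreover have "space (restrict_space M A) = A"
    using sets.sets_into_space[OF A] by (auto simp: space_restrict_space)
  ultimately show ?thesis
    using A by (simp add: sets_restrict_space_iff)
qed

lemma (in sigma_finite_measure) set_nn_integral_layer_cake:
  fixes f :: "'a \<Rightarrow> real"
  assumes "f \<in> borel_measurable (restrict_space M A)" "A \<in> sets M"
  shows "(\<integral>\<^sup>+x\<in>A. ennreal (f x) \<partial>M) = (\<integral>\<^sup>+s\<in>{0..}. emeasure M {x\<in>A. s < f x} \<partial>lborel)"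
  using set_nn_integral_mult_layer_cake[OF assms, of "\<lambda>_. 1"] superlevel_in_sets[OF assms] by simp

interpretation lebesgue: sigma_finite_measure "lebesgue :: real measure"
  by (rule lborel.sigma_finite_measure_completion)

lemma ennreal_set_lebesgue_integral:
  fixes f :: "'a \<Rightarrow> real"
  assumes "set_integrable M A f" and "AE x\<in>A in M. 0 \<le> f x"
  shows "ennreal (LINT x:A|M. f x) = (\<integral>\<^sup>+x\<in>A. ennreal (f x) \<partial>M)"
proof -
  have "ennreal (LINT x:A|M. f x) = (\<integral>\<^sup>+x. ennreal (indicator A x *\<^sub>R f x) \<partial>M)"
    unfolding set_lebesgue_integral_def
    by (rule nn_integral_eq_integral[symmetric])
      (use assms in \<open>auto simp: set_integrable_def indicator_def elim: eventually_mono\<close>)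
  also have "\<dots> = (\<integral>\<^sup>+x\<in>A. ennreal (f x) \<partial>M)"
    by (intro nn_integral_cong) (simp add: indicator_def)
  finally show ?thesis .
qed

lemma set_lebesgue_integral_nonneg:
  fixes f :: "'a \<Rightarrow> real"
  assumes "AE x\<in>A in M. 0 \<le> f x"
  shows "0 \<le> (LINT x:A|M. f x)"
  unfolding set_lebesgue_integral_def using assms
  by (intro integral_nonneg_AE) (auto simp: indicator_def elim: eventually_mono)

lemma set_lebesgue_integral_eq_zero_iff:
  fixes f :: "'a \<Rightarrow> real"
  assumes "set_integrable M A f" and "AE x\<in>A in M. 0 \<le> f x"
  shows "(LINT x:A|M. f x) = 0 \<longleftrightarrow> (AE x\<in>A in M. f x = 0)"
proof -
  have "(LINT x:A|M. f x) = 0 \<longleftrightarrow> (AE x in M. indicator A x *\<^sub>R f x = 0)"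
    unfolding set_lebesgue_integral_def using assms unfolding set_integrable_def
    by (intro integral_nonneg_eq_0_iff_AE) (auto simp: indicator_def elim: eventually_mono)
  also have "\<dots> \<longleftrightarrow> (AE x\<in>A in M. f x = 0)"
    by (intro AE_cong) (auto simp: indicator_def)
  finally show ?thesis .
qed

lemma set_lebesgue_integral_cong_AE_integrable:
  fixes f g :: "'a \<Rightarrow> real"
  assumes "set_integrable M A f" "set_integrable M A g" "AE x\<in>A in M. f x = g x"
  shows "(LINT x:A|M. f x) = (LINT x:A|M. g x)"
  unfolding set_lebesgue_integral_def using assms unfolding set_integrable_def
  by (intro integral_cong_AE) (auto elim: eventually_mono simp: indicator_def)

lemma set_integrable_bounded:
  fixes f :: "'a::euclidean_space \<Rightarrow> real"
  assumes "f \<in> borel_measurable (lebesgue_on A)" "A \<in> lmeasurable" "\<And>x. x \<in> A \<Longrightarrow> \<bar>f x\<bar> \<le> B"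
  shows "set_integrable lebesgue A f"
  using assms
  by (intro measurable_bounded_by_integrable_imp_absolutely_integrable[OF _ _ integrable_on_const])
    auto

lemma set_integrable_mono_comp:
  fixes \<phi> :: "real \<Rightarrow> real" and f :: "'a::euclidean_space \<Rightarrow> real"
  assumes \<phi>: "mono \<phi>" and f: "f \<in> borel_measurable (lebesgue_on A)" and A: "A \<in> lmeasurable"
    and bounds: "\<And>x. x \<in> A \<Longrightarrow> l \<le> f x" "\<And>x. x \<in> A \<Longrightarrow> f x \<le> h"
  shows "set_integrable lebesgue A (\<lambda>x. \<phi> (f x))"
proof (rule set_integrable_bounded[OF _ A])
  show "(\<lambda>x. \<phi> (f x)) \<in> borel_measurable (lebesgue_on A)"
    using f borel_measurable_mono[OF \<phi>] by measurable
  show "\<bar>\<phi> (f x)\<bar> \<le> \<bar>\<phi> l\<bar> + \<bar>\<phi> h\<bar>" if "x \<in> A" for x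
    using monoD[OF \<phi> bounds(1)[OF that]] monoD[OF \<phi> bounds(2)[OF that]] by linarith
qed

lemma set_integrable_continuous_mult:
  fixes k g :: "real \<Rightarrow> real"
  assumes k: "continuous_on {a..b} k" and g: "set_integrable lebesgue {a..b} g"
  shows "set_integrable lebesgue {a..b} (\<lambda>y. k y * g y)"
proof (rule absolutely_integrable_bounded_measurable_product_real[OF _ _ _ g])
  show "k \<in> borel_measurable (lebesgue_on {a..b})"
    by (rule continuous_imp_measurable_on_sets_lebesgue[OF k]) simp
  show "bounded (k ` {a..b})"
    by (intro compact_imp_bounded compact_continuous_image k compact_Icc)
qed simp

lemma ennreal_set_integral_bounded_mult:
  fixes k g :: "real \<Rightarrow> real"
  assumes k: "k \<in> borel_measurable lebesgue" "\<And>x. x \<in> A \<Longrightarrow> 0 \<le> k x" "\<And>x. x \<in> A \<Longrightarrow> k x \<le> B"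
    and g: "set_integrable lebesgue A g" "AE x\<in>A in lebesgue. 0 \<le> g x" and A: "A \<in> sets lebesgue"
  shows "ennreal (LINT x:A|lebesgue. k x * g x) = (\<integral>\<^sup>+x\<in>A. ennreal (k x) * ennreal (g x) \<partial>lebesgue)"
proof -
  have "bounded (k ` A)" using k(2,3) by (intro boundedI[of _ B]) auto
  then have int: "set_integrable lebesgue A (\<lambda>x. k x * g x)"
    by (intro absolutely_integrable_bounded_measurable_product_real measurable_restrict_space1
        k(1) g(1) A)
  have "AE x\<in>A in lebesgue. 0 \<le> k x * g x"
    using g(2) k(2) by (auto elim!: eventually_mono)
  then have "ennreal (LINT x:A|lebesgue. k x * g x) = (\<integral>\<^sup>+x\<in>A. ennreal (k x * g x) \<partial>lebesgue)"
    by (rule ennreal_set_lebesgue_integral[OF int])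
  also have "\<dots> = (\<integral>\<^sup>+x\<in>A. ennreal (k x) * ennreal (g x) \<partial>lebesgue)"
    using k(2) by (intro set_nn_integral_cong) (auto simp: ennreal_mult')
  finally show ?thesis .
qed

lemma tendsto_set_integral_bounded_mult:
  fixes k :: "nat \<Rightarrow> 'a \<Rightarrow> real"
  assumes d: "set_integrable M A d" and k_d: "\<And>n. set_integrable M A (\<lambda>y. k n y * d y)"
    and l_d: "set_integrable M A (\<lambda>y. l y * d y)" and bound: "\<And>n y. y \<in> A \<Longrightarrow> \<bar>k n y\<bar> \<le> B"
    and lim: "AE y\<in>A in M. (\<lambda>n. k n y) \<longlonglongrightarrow> l y"
  shows "(\<lambda>n. LINT y:A|M. k n y * d y) \<longlonglongrightarrow> (LINT y:A|M. l y * d y)"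
  unfolding set_lebesgue_integral_def
proof (rule integral_dominated_convergence[where w="\<lambda>y. B * norm (indicator A y *\<^sub>R d y)"])
  show "integrable M (\<lambda>y. B * norm (indicator A y *\<^sub>R d y))"
    using d unfolding set_integrable_def by (intro integrable_mult_right integrable_norm)
  show "(\<lambda>y. indicator A y *\<^sub>R (l y * d y)) \<in> borel_measurable M"
    using l_d unfolding set_integrable_def by (rule borel_measurable_integrable)
  show "(\<lambda>y. indicator A y *\<^sub>R (k n y * d y)) \<in> borel_measurable M" for n
    using k_d unfolding set_integrable_def by (rule borel_measurable_integrable)
  show "AE y in M. norm (indicator A y *\<^sub>R (k n y * d y)) \<le> B * norm (indicator A y *\<^sub>R d y)" for n
    using bound by (intro AE_I2) (auto simp: indicator_def abs_mult intro: mult_right_mono)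
  show "AE y in M. (\<lambda>n. indicator A y *\<^sub>R (k n y * d y)) \<longlonglongrightarrow> indicator A y *\<^sub>R (l y * d y)"
    using lim by eventually_elim (auto simp: indicator_def intro!: tendsto_mult)
qed

lemma AE_lebesgue_notin_finite: "finite N \<Longrightarrow> AE x in lebesgue. x \<notin> N"
  by (intro AE_not_in null_sets_completionI finite_imp_null_set_lborel)

lemma AE_lebesgue_Icc_iff_Ioo:
  fixes a b :: real
  shows "(AE x\<in>{a..b} in lebesgue. P x) \<longleftrightarrow> (AE x\<in>{a<..<b} in lebesgue. P x)"
proof
  assume "AE x\<in>{a<..<b} in lebesgue. P x"
  moreover have "AE x in lebesgue. x \<notin> {a, b}"
    by (rule AE_lebesgue_notin_finite) simp
  ultimately show "AE x\<in>{a..b} in lebesgue. P x"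
    by eventually_elim auto
qed (auto elim: eventually_mono)

lemma continuous_AE_imp_eq:
  fixes g h :: "real \<Rightarrow> real"
  assumes "continuous_on UNIV g" "continuous_on UNIV h"
    and "AE x\<in>{a<..<b} in lebesgue. g x = h x" "x \<in> {a<..<b}"
  shows "g x = h x"
proof -
  have "x \<in> {x. g x = h x}"
    using assms(3)
    by (intro mem_closed_if_AE_lebesgue_open[OF open_greaterThanLessThan _ _ assms(4)]
        closed_Collect_eq assms(1,2)) simp
  then show ?thesis by simp
qed

section \<open>Centred majorants\<close>

definition sym_decreasing_on :: "real \<Rightarrow> (real \<Rightarrow> real) \<Rightarrow> bool" where
  "sym_decreasing_on c V \<longleftrightarrow> (\<forall>x y. \<bar>x\<bar> \<le> \<bar>y\<bar> \<and> \<bar>y\<bar> \<le> c \<longrightarrow> V y \<le> V x)"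

text \<open>Two points of a superlevel set of \<open>U\<close> are never further apart than the length of the
  corresponding superlevel set of \<open>V\<close>, which is an interval centred at the origin.\<close>
definition centred_majorant :: "real \<Rightarrow> (real \<Rightarrow> real) \<Rightarrow> (real \<Rightarrow> real) \<Rightarrow> bool" where
  "centred_majorant c U V \<longleftrightarrow> sym_decreasing_on c V \<and>
    (\<forall>x y. -c \<le> x \<and> x \<le> y \<and> y \<le> c \<longrightarrow> min (U x) (U y) \<le> V ((y - x) / 2))"

lemma sym_decreasing_onD: "\<lbrakk>sym_decreasing_on c V; \<bar>x\<bar> \<le> \<bar>y\<bar>; \<bar>y\<bar> \<le> c\<rbrakk> \<Longrightarrow> V y \<le> V x"
  by (auto simp: sym_decreasing_on_def)

lemma centred_majorant_sym_decreasing: "centred_majorant c U V \<Longrightarrow> sym_decreasing_on c V"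
  by (simp add: centred_majorant_def)

lemma centred_majorantD:
  "\<lbrakk>centred_majorant c U V; -c \<le> x; x \<le> y; y \<le> c\<rbrakk> \<Longrightarrow> min (U x) (U y) \<le> V ((y - x) / 2)"
  by (auto simp: centred_majorant_def)

lemma centred_majorant_le_centre: "\<lbrakk>centred_majorant c U V; \<bar>x\<bar> \<le> c\<rbrakk> \<Longrightarrow> U x \<le> V 0"
  using centred_majorantD[of c U V x x] by auto

lemma sym_decreasing_on_imp_centred_majorant:
  assumes V: "sym_decreasing_on c V"
  shows "centred_majorant c V V"
  unfolding centred_majorant_def
proof (intro conjI V allI impI)
  fix x y assume xy: "-c \<le> x \<and> x \<le> y \<and> y \<le> c"
  then consider "\<bar>(y - x) / 2\<bar> \<le> \<bar>x\<bar>" | "\<bar>(y - x) / 2\<bar> \<le> \<bar>y\<bar>" by fastforce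
  then show "min (V x) (V y) \<le> V ((y - x) / 2)"
    using V xy by cases (auto simp: min_le_iff_disj abs_le_iff intro: sym_decreasing_onD)
qed

lemma centred_majorant_mono_comp:
  fixes \<phi> :: "real \<Rightarrow> real"
  assumes "centred_majorant c U V" and "mono \<phi>"
  shows "centred_majorant c (\<lambda>x. \<phi> (U x)) (\<lambda>x. \<phi> (V x))"
  using assms unfolding centred_majorant_def sym_decreasing_on_def
  by (simp add: min_of_mono monoD)

lemma is_interval_superlevel_sym_decreasing:
  assumes V: "sym_decreasing_on c V" and \<rho>: "\<rho> \<le> c"
  shows "is_interval {x\<in>{-\<rho>..\<rho>}. s < V x}"
  unfolding is_interval_1
proof (intro ballI allI impI)
  fix a b x assume ab: "a \<in> {x\<in>{-\<rho>..\<rho>}. s < V x}" "b \<in> {x\<in>{-\<rho>..\<rho>}. s < V x}" and "a \<le> x \<and> x \<le> b"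
  then have "\<bar>x\<bar> \<le> \<bar>a\<bar> \<or> \<bar>x\<bar> \<le> \<bar>b\<bar>" "\<bar>a\<bar> \<le> c" "\<bar>b\<bar> \<le> c" "x \<in> {-\<rho>..\<rho>}" using \<rho> by auto
  then have "V a \<le> V x \<or> V b \<le> V x" using sym_decreasing_onD[OF V] by blast
  with ab \<open>x \<in> {-\<rho>..\<rho>}\<close> show "x \<in> {x\<in>{-\<rho>..\<rho>}. s < V x}" by auto
qed

lemma borel_measurable_sym_decreasing_on:
  assumes V: "sym_decreasing_on c V"
  shows "V \<in> borel_measurable (lebesgue_on {-c..c})"
  unfolding borel_measurable_iff_greater space_lebesgue_on
proof
  fix s
  have "{x\<in>{-c..c}. s < V x} \<in> sets borel"
    by (intro real_interval_borel_measurable is_interval_superlevel_sym_decreasing[OF V] order_refl)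
  then show "{x\<in>{-c..c}. s < V x} \<in> sets (lebesgue_on {-c..c})"
    by (intro sets_restrict_space_iff[THEN iffD2]) auto
qed

lemma sym_decreasing_on_if_concave_even:
  assumes V: "concave_on UNIV V" and even: "\<And>x. V (- x) = V x"
  shows "sym_decreasing_on c V"
  unfolding sym_decreasing_on_def
proof (intro allI impI)
  fix x y assume "\<bar>x\<bar> \<le> \<bar>y\<bar> \<and> \<bar>y\<bar> \<le> c"
  then have "x \<in> {- \<bar>y\<bar>..\<bar>y\<bar>}" by auto
  then have "min (V (- \<bar>y\<bar>)) (V \<bar>y\<bar>) \<le> V x"
    using V by (intro concave_on_ge_min) (simp_all add: concave_on_iff)
  then show "V y \<le> V x" using even[of y] by (auto simp: abs_if split: if_splits)
qed

lemma emeasure_lebesgue_le_width: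
  fixes A :: "real set"
  assumes width: "\<And>x y. \<lbrakk>x \<in> A; y \<in> A; x \<le> y\<rbrakk> \<Longrightarrow> y - x \<le> d"
  shows "emeasure lebesgue A \<le> ennreal d"
proof (cases "A = {}")
  case False
  then obtain z where z: "z \<in> A" by blast
  have above: "y - d \<le> x" if "x \<in> A" "y \<in> A" for x y
    using width[OF that] width[OF z z] by linarith
  have "bdd_below A" using above[OF _ z] by (rule bdd_belowI)
  then have "A \<subseteq> {Inf A..Inf A + d}"
    using above False
    by (fastforce simp: cInf_lower le_cInf_iff diff_le_eq[symmetric] intro!: cInf_greatest)
  then have "emeasure lebesgue A \<le> emeasure lebesgue {Inf A..Inf A + d}"
    by (intro emeasure_mono) auto
  also have "\<dots> = ennreal d" using width[OF z z] by simp
  finally show ?thesis .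
qed simp

lemma centred_interval_subset_superlevel:
  assumes UV: "centred_majorant c U V" and xy: "-c \<le> x" "x \<le> y" "y \<le> c" and s: "s < U x" "s < U y"
  shows "{-((y - x) / 2)<..<(y - x) / 2} \<subseteq> {z. s < V z}"
proof
  fix z assume "z \<in> {-((y - x) / 2)<..<(y - x) / 2}"
  then have "- ((y - x) / 2) < z" "z < (y - x) / 2" by simp_all
  then have "\<bar>z\<bar> \<le> \<bar>(y - x) / 2\<bar>" by linarith
  then have "V ((y - x) / 2) \<le> V z"
    using xy by (intro sym_decreasing_onD[OF centred_majorant_sym_decreasing[OF UV]]) auto
  then show "z \<in> {z. s < V z}" using centred_majorantD[OF UV xy] s by simp
qed

lemma emeasure_superlevel_le_centred_majorant:
  assumes UV: "centred_majorant c U V"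
    and E: "E \<in> sets lebesgue" "E \<subseteq> {-c..c}" "emeasure lebesgue E \<le> ennreal (2 * \<rho>)" and \<rho>: "\<rho> \<le> c"
  shows "emeasure lebesgue {x\<in>E. s < U x} \<le> emeasure lebesgue {x\<in>{-\<rho>..\<rho>}. s < V x}"
    (is "emeasure lebesgue ?A \<le> emeasure lebesgue ?B")
proof (cases "ennreal (2 * \<rho>) \<le> emeasure lebesgue ?B")
  case True
  have "emeasure lebesgue ?A \<le> emeasure lebesgue E" using E(1) by (intro emeasure_mono) auto
  also note E(3)
  also note True
  finally show ?thesis .
next
  case False
  have "is_interval ?B"
    by (rule is_interval_superlevel_sym_decreasing[OF centred_majorant_sym_decreasing[OF UV] \<rho>])
  then have B: "?B \<in> sets lebesgue" by (simp add: real_interval_borel_measurable)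
  have finite: "emeasure lebesgue ?B = ennreal (measure lebesgue ?B)"
    by (rule emeasure_eq_ennreal_measure) (use False in \<open>auto simp: top_unique\<close>)
  have "emeasure lebesgue ?A \<le> ennreal (measure lebesgue ?B)"
  proof (rule emeasure_lebesgue_le_width)
    fix x y assume x: "x \<in> ?A" and y: "y \<in> ?A" and "x \<le> y"
    define m where "m = min \<rho> ((y - x) / 2)"
    have "{-((y - x) / 2)<..<(y - x) / 2} \<subseteq> {z. s < V z}"
      using x y E(2) \<open>x \<le> y\<close> by (intro centred_interval_subset_superlevel[OF UV]) auto
    then have "{-m<..<m} \<subseteq> ?B" by (auto simp: m_def subset_eq)
    then have "emeasure lebesgue {-m<..<m} \<le> emeasure lebesgue ?B" using B by (rule emeasure_mono)
    then have le: "ennreal (2 * m) \<le> emeasure lebesgue ?B"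
      by (cases "0 \<le> m") (simp_all add: ennreal_neg)
    with False have "m \<noteq> \<rho>" by blast
    then have "2 * m = y - x" by (simp add: m_def min_def split: if_splits)
    with le show "y - x \<le> measure lebesgue ?B"
      unfolding finite by (simp add: ennreal_le_iff)
  qed
  then show ?thesis unfolding finite .
qed

lemma set_nn_integral_le_centred_majorant:
  assumes UV: "centred_majorant c U V" and U: "U \<in> borel_measurable (lebesgue_on {-c..c})"
    and E: "E \<in> sets lebesgue" "E \<subseteq> {-c..c}" "emeasure lebesgue E \<le> ennreal (2 * \<rho>)" and \<rho>: "\<rho> \<le> c"
  shows "(\<integral>\<^sup>+x\<in>E. ennreal (U x) \<partial>lebesgue) \<le> (\<integral>\<^sup>+x\<in>{-\<rho>..\<rho>}. ennreal (V x) \<partial>lebesgue)"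
proof -
  have V: "V \<in> borel_measurable (lebesgue_on {-c..c})"
    by (rule borel_measurable_sym_decreasing_on[OF centred_majorant_sym_decreasing[OF UV]])
  have UE: "U \<in> borel_measurable (lebesgue_on E)" by (rule measurable_restrict_mono[OF U E(2)])
  have V\<rho>: "V \<in> borel_measurable (lebesgue_on {-\<rho>..\<rho>})"
    by (rule measurable_restrict_mono[OF V]) (use \<rho> in auto)
  have interval: "{-\<rho>..\<rho>} \<in> sets lebesgue" by simp
  show ?thesis
    unfolding lebesgue.set_nn_integral_layer_cake[OF UE E(1)]
      lebesgue.set_nn_integral_layer_cake[OF V\<rho> interval]
    by (intro nn_integral_mono mult_right_mono zero_le
        emeasure_superlevel_le_centred_majorant[OF UV E \<rho>])
qed

lemma centred_majorant_lower_bound: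
  assumes UV: "centred_majorant c U V" and U: "\<And>x. \<bar>x\<bar> \<le> c \<Longrightarrow> m \<le> U x" and x: "\<bar>x\<bar> \<le> c"
  shows "m \<le> V x"
proof -
  have "m \<le> min (U (- \<bar>x\<bar>)) (U \<bar>x\<bar>)" using U x by simp
  also have "\<dots> \<le> V \<bar>x\<bar>" using centred_majorantD[OF UV, of "- \<bar>x\<bar>" "\<bar>x\<bar>"] x by simp
  also have "\<dots> \<le> V x"
    using sym_decreasing_onD[OF centred_majorant_sym_decreasing[OF UV], of x "\<bar>x\<bar>"] x by simp
  finally show ?thesis .
qed

lemma set_integral_le_centred_majorant:
  assumes UV: "centred_majorant c U V" and U: "U \<in> borel_measurable (lebesgue_on {-c..c})"
    and nonneg: "\<And>x. \<bar>x\<bar> \<le> c \<Longrightarrow> 0 \<le> U x"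
    and E: "E \<in> sets lebesgue" "E \<subseteq> {-c..c}" "measure lebesgue E \<le> 2 * \<rho>" and \<rho>: "\<rho> \<le> c"
  shows "(LINT x:E|lebesgue. U x) \<le> (LINT x:{-\<rho>..\<rho>}|lebesgue. V x)"
proof -
  have V: "sym_decreasing_on c V" by (rule centred_majorant_sym_decreasing[OF UV])
  have lmeasurable_E: "E \<in> lmeasurable"
    by (rule fmeasurableI2[OF lmeasurable_interval(1) E(2,1)])
  then have emeasure_E: "emeasure lebesgue E \<le> ennreal (2 * \<rho>)"
    using E(3) by (simp add: emeasure_eq_measure2 ennreal_leI)
  have bounds_U: "0 \<le> U x" "U x \<le> V 0" if "x \<in> E" for x
    using that E(2) nonneg[of x] centred_majorant_le_centre[OF UV, of x] by (auto simp: subset_eq)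
  have bounds_V: "0 \<le> V x" "V x \<le> V 0" if "x \<in> {-\<rho>..\<rho>}" for x
    using that \<rho> centred_majorant_lower_bound[OF UV nonneg, of x] sym_decreasing_onD[OF V, of 0 x]
    by auto
  have int_U: "set_integrable lebesgue E U"
    using measurable_restrict_mono[OF U E(2)] bounds_U
    by (intro set_integrable_bounded[OF _ lmeasurable_E, where B="V 0"]) auto
  have int_V: "set_integrable lebesgue {-\<rho>..\<rho>} V"
    using measurable_restrict_mono[OF borel_measurable_sym_decreasing_on[OF V], of "{-\<rho>..\<rho>}"]
      bounds_V \<rho>
    by (intro set_integrable_bounded[where B="V 0"]) auto
  have "ennreal (LINT x:E|lebesgue. U x) \<le> ennreal (LINT x:{-\<rho>..\<rho>}|lebesgue. V x)"
    using set_nn_integral_le_centred_majorant[OF UV U E(1,2) emeasure_E \<rho>]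
    by (simp add: ennreal_set_lebesgue_integral int_U int_V bounds_U bounds_V)
  moreover have "0 \<le> (LINT x:{-\<rho>..\<rho>}|lebesgue. V x)"
    by (rule set_lebesgue_integral_nonneg) (simp add: bounds_V)
  ultimately show ?thesis by (simp add: ennreal_le_iff)
qed

lemma centred_majorant_comp_integrable:
  fixes \<phi> :: "real \<Rightarrow> real"
  assumes \<phi>: "mono \<phi>" and UV: "centred_majorant c U V"
    and U: "U \<in> borel_measurable (lebesgue_on {-c..c})" and lower: "\<And>x. \<bar>x\<bar> \<le> c \<Longrightarrow> m \<le> U x"
  shows "set_integrable lebesgue {-c..c} (\<lambda>x. \<phi> (U x))"
    and "set_integrable lebesgue {-c..c} (\<lambda>x. \<phi> (V x))"
proof -
  have V: "sym_decreasing_on c V" by (rule centred_majorant_sym_decreasing[OF UV])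
  show "set_integrable lebesgue {-c..c} (\<lambda>x. \<phi> (U x))"
    by (rule set_integrable_mono_comp[OF \<phi> U, where l=m and h="V 0"])
      (auto intro: lower centred_majorant_le_centre[OF UV])
  show "set_integrable lebesgue {-c..c} (\<lambda>x. \<phi> (V x))"
    by (rule set_integrable_mono_comp[OF \<phi> borel_measurable_sym_decreasing_on[OF V],
          where l=m and h="V 0"])
      (auto intro: centred_majorant_lower_bound[OF UV lower] sym_decreasing_onD[OF V])
qed

lemma integral_comp_le_centred_majorant:
  fixes \<phi> :: "real \<Rightarrow> real"
  assumes \<phi>: "mono \<phi>" and UV: "centred_majorant c U V"
    and U: "U \<in> borel_measurable (lebesgue_on {-c..c})" and lower: "\<And>x. \<bar>x\<bar> \<le> c \<Longrightarrow> m \<le> U x"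
    and c: "0 \<le> c"
  shows "(LINT x:{-c..c}|lebesgue. \<phi> (U x)) \<le> (LINT x:{-c..c}|lebesgue. \<phi> (V x))"
proof -
  have "(LINT x:{-c..c}|lebesgue. \<phi> (U x) - \<phi> m) \<le> (LINT x:{-c..c}|lebesgue. \<phi> (V x) - \<phi> m)"
  proof (rule set_integral_le_centred_majorant)
    have "mono (\<lambda>z. \<phi> z - \<phi> m)" using \<phi> by (simp add: mono_def)
    then show "centred_majorant c (\<lambda>x. \<phi> (U x) - \<phi> m) (\<lambda>x. \<phi> (V x) - \<phi> m)"
      using centred_majorant_mono_comp[OF UV] by blast
    show "(\<lambda>x. \<phi> (U x) - \<phi> m) \<in> borel_measurable (lebesgue_on {-c..c})"
      using U borel_measurable_mono[OF \<phi>] by measurable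
    show "0 \<le> \<phi> (U x) - \<phi> m" if "\<bar>x\<bar> \<le> c" for x using monoD[OF \<phi> lower[OF that]] by simp
  qed (use c in auto)
  moreover have "set_integrable lebesgue {-c..c} (\<lambda>x. \<phi> m)"
    by (rule set_integrable_bounded) auto
  ultimately show ?thesis
    by (simp add: centred_majorant_comp_integrable[OF \<phi> UV U lower] set_integral_diff)
qed

lemma star_fun_le_centred_majorant:
  assumes UV: "centred_majorant pi U V" and U: "U \<in> borel_measurable (lebesgue_on {-pi..pi})"
    and nonneg: "\<And>x. \<bar>x\<bar> \<le> pi \<Longrightarrow> 0 \<le> U x" and t: "t \<in> {0..2 * pi}"
  shows "star_fun U t \<le> star_fun V t"
proof -
  let ?C = "{-(t / 2)..t / 2}"
  let ?S = "\<lambda>g. {(LINT x:E|lebesgue. g x) | E.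
    E \<in> sets borel \<and> E \<subseteq> {-pi..pi} \<and> measure lebesgue E = t}"
  have "?C \<in> sets borel \<and> ?C \<subseteq> {-pi..pi} \<and> measure lebesgue ?C = t" using t by auto
  then have C: "(LINT x:?C|lebesgue. W x) \<in> ?S W" for W by blast
  have V: "sym_decreasing_on pi V" by (rule centred_majorant_sym_decreasing[OF UV])
  have le: "z \<le> (LINT x:?C|lebesgue. V x)"
    if W: "centred_majorant pi W V" "W \<in> borel_measurable (lebesgue_on {-pi..pi})"
      "\<And>x. \<bar>x\<bar> \<le> pi \<Longrightarrow> 0 \<le> W x" and z: "z \<in> ?S W" for W z
  proof -
    obtain E where E: "E \<in> sets borel" "E \<subseteq> {-pi..pi}" "measure lebesgue E = t"
        and z: "z = (LINT x:E|lebesgue. W x)"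
      using z by blast
    show ?thesis
      unfolding z using E t by (intro set_integral_le_centred_majorant[OF W]) auto
  qed
  have "star_fun U t \<le> (LINT x:?C|lebesgue. V x)"
    unfolding star_fun_def using C[of U] by (intro cSup_least le[OF UV U nonneg]) blast+
  also have "\<dots> = star_fun V t"
    unfolding star_fun_def
    by (rule cSup_eq_maximum[symmetric, OF C])
      (rule le[OF sym_decreasing_on_imp_centred_majorant[OF V]
          borel_measurable_sym_decreasing_on[OF V] centred_majorant_lower_bound[OF UV nonneg]])
  finally show ?thesis .
qed

text \<open>Superlevel sets are replaced by their convex hulls, moved to the origin.\<close>
definition centred_hull :: "real \<Rightarrow> (real \<Rightarrow> real) \<Rightarrow> real \<Rightarrow> real" where
  "centred_hull c U x = Sup {min (U a) (U b) | a b. -c \<le> a \<and> b \<le> c \<and> 2 * \<bar>x\<bar> \<le> b - a}"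

lemma centred_hull_attained:
  assumes U: "continuous_on {-c..c} U" and x: "\<bar>x\<bar> \<le> c"
  obtains a b where "-c \<le> a" "b \<le> c" "2 * \<bar>x\<bar> \<le> b - a" "centred_hull c U x = min (U a) (U b)"
proof -
  define C where "C = ({-c..c} \<times> {-c..c}) \<inter> {p. 2 * \<bar>x\<bar> \<le> snd p - fst p}"
  define m where "m = (\<lambda>p. min (U (fst p)) (U (snd p)))"
  have C_iff: "(a, b) \<in> C \<longleftrightarrow> -c \<le> a \<and> b \<le> c \<and> 2 * \<bar>x\<bar> \<le> b - a" for a b by (auto simp: C_def)
  then have hull: "centred_hull c U x = Sup (m ` C)"
    unfolding centred_hull_def by (intro arg_cong[where f=Sup]) (force simp: m_def)
  have "compact C"
    unfolding C_def
    by (intro compact_Int_closed compact_Times closed_Collect_le continuous_intros compact_Icc)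
  moreover have "C \<noteq> {}" using x C_iff[of "- \<bar>x\<bar>" "\<bar>x\<bar>"] by auto
  moreover have "continuous_on C m"
    unfolding m_def by (intro continuous_intros continuous_on_compose2[OF U]) (auto simp: C_def)
  ultimately obtain p where p: "p \<in> C" "\<And>q. q \<in> C \<Longrightarrow> m q \<le> m p"
    using continuous_attains_sup[of C m] by blast
  have "centred_hull c U x = m p"
    unfolding hull by (rule cSup_eq_maximum) (use p in auto)
  then show thesis
    using that[of "fst p" "snd p"] p(1) C_iff[of "fst p" "snd p"] by (simp add: m_def)
qed

lemma centred_hull_upper:
  assumes U: "continuous_on {-c..c} U" and ab: "-c \<le> a" "b \<le> c" "2 * \<bar>x\<bar> \<le> b - a"
  shows "min (U a) (U b) \<le> centred_hull c U x"
  unfolding centred_hull_def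
proof (rule cSup_upper)
  show "min (U a) (U b) \<in> {min (U a) (U b) |a b. -c \<le> a \<and> b \<le> c \<and> 2 * \<bar>x\<bar> \<le> b - a}"
    using ab by blast
  obtain B where B: "\<And>y. y \<in> {-c..c} \<Longrightarrow> U y \<le> B"
    using continuous_attains_sup[OF compact_Icc _ U] ab by fastforce
  show "bdd_above {min (U a) (U b) |a b. -c \<le> a \<and> b \<le> c \<and> 2 * \<bar>x\<bar> \<le> b - a}"
  proof (rule bdd_aboveI)
    fix y assume "y \<in> {min (U a) (U b) |a b. -c \<le> a \<and> b \<le> c \<and> 2 * \<bar>x\<bar> \<le> b - a}"
    then obtain a b where "y = min (U a) (U b)" "a \<in> {-c..c}" by force
    then show "y \<le> B" using B[of a] by simp
  qed
qed

lemma centred_hull_is_centred_majorant: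
  assumes U: "continuous_on {-c..c} U"
  shows "centred_majorant c U (centred_hull c U)"
  unfolding centred_majorant_def sym_decreasing_on_def
proof (intro conjI allI impI)
  fix x y assume xy: "\<bar>x\<bar> \<le> \<bar>y\<bar> \<and> \<bar>y\<bar> \<le> c"
  then obtain a b where "-c \<le> a" "b \<le> c" "2 * \<bar>y\<bar> \<le> b - a" "centred_hull c U y = min (U a) (U b)"
    by (auto intro: centred_hull_attained[OF U])
  with xy show "centred_hull c U y \<le> centred_hull c U x"
    by (auto intro: centred_hull_upper[OF U])
next
  fix x y assume "-c \<le> x \<and> x \<le> y \<and> y \<le> c"
  then show "min (U x) (U y) \<le> centred_hull c U ((y - x) / 2)"
    by (intro centred_hull_upper[OF U]) auto
qed
lemma centred_hull_le_centred_majorant: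
  assumes U: "continuous_on {-c..c} U" and UV: "centred_majorant c U V" and x: "\<bar>x\<bar> \<le> c"
  shows "centred_hull c U x \<le> V x"
proof -
  obtain a b where ab: "-c \<le> a" "b \<le> c" "2 * \<bar>x\<bar> \<le> b - a" "centred_hull c U x = min (U a) (U b)"
    by (rule centred_hull_attained[OF U x])
  have "min (U a) (U b) \<le> V ((b - a) / 2)" using ab by (intro centred_majorantD[OF UV]) auto
  also have "\<dots> \<le> V x"
    using ab by (intro sym_decreasing_onD[OF centred_majorant_sym_decreasing[OF UV]]) auto
  finally show ?thesis unfolding ab(4) .
qed

lemma centred_hull_eq_AE_if_integral_comp_eq:
  fixes \<phi> :: "real \<Rightarrow> real"
  assumes \<phi>: "strict_mono \<phi>" and U: "continuous_on {-c..c} U" and UV: "centred_majorant c U V"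
    and c: "0 \<le> c" and eq: "(LINT x:{-c..c}|lebesgue. \<phi> (U x)) = (LINT x:{-c..c}|lebesgue. \<phi> (V x))"
  shows "AE x\<in>{-c..c} in lebesgue. centred_hull c U x = V x"
proof -
  let ?H = "centred_hull c U"
  have mono: "mono \<phi>" by (rule strict_mono_mono[OF \<phi>])
  have meas: "U \<in> borel_measurable (lebesgue_on {-c..c})"
    by (rule continuous_imp_measurable_on_sets_lebesgue[OF U]) simp
  obtain z where "\<forall>x\<in>{-c..c}. U z \<le> U x"
    using continuous_attains_inf[OF compact_Icc _ U] c by force
  then have lower: "U z \<le> U x" if "\<bar>x\<bar> \<le> c" for x using that by (auto simp: abs_le_iff)
  note hull = centred_hull_is_centred_majorant[OF U]
  note int_H = centred_majorant_comp_integrable(2)[OF mono hull meas lower]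
  note int_V = centred_majorant_comp_integrable(2)[OF mono UV meas lower]
  have le: "\<phi> (?H x) \<le> \<phi> (V x)" if "x \<in> {-c..c}" for x
    using that by (intro monoD[OF mono] centred_hull_le_centred_majorant[OF U UV]) auto
  have "(LINT x:{-c..c}|lebesgue. \<phi> (?H x)) = (LINT x:{-c..c}|lebesgue. \<phi> (V x))"
    using integral_comp_le_centred_majorant[OF mono hull meas lower c]
      set_integral_mono[OF int_H int_V le] eq by linarith
  then have "AE x in lebesgue. indicator {-c..c} x *\<^sub>R \<phi> (?H x) = indicator {-c..c} x *\<^sub>R \<phi> (V x)"
    using int_H int_V le unfolding set_integrable_def set_lebesgue_integral_def
    by (intro integral_ineq_eq_0_then_AE) (auto simp: indicator_def)
  then show ?thesis
    by eventually_elim (auto simp: strict_mono_eq[OF \<phi>])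
qed

section \<open>Trapezoids built from the Green function\<close>

lemma G_eq:
  "G x y = (if x \<le> y then (pi + x) * (pi - y) / (2 * pi) else (pi - x) * (pi + y) / (2 * pi))"
  by (simp add: G_def field_simps abs_if)

lemma G_nonneg: "\<lbrakk>x \<in> {-pi..pi}; y \<in> {-pi..pi}\<rbrakk> \<Longrightarrow> 0 \<le> G x y"
  by (auto simp: G_eq)

lemma G_pos: "\<lbrakk>x \<in> {-pi<..<pi}; y \<in> {-pi<..<pi}\<rbrakk> \<Longrightarrow> 0 < G x y"
  by (auto simp: G_eq)

lemma continuous_on_G: "continuous_on S (G x)"
  unfolding G_def by (intro continuous_intros) auto

text \<open>The weights make the combination constant between \<open>a\<close> and \<open>b\<close>. For \<open>a = -pi\<close> and \<open>b = pi\<close> it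
  vanishes, as a division by zero.\<close>
definition trapezoid :: "real \<Rightarrow> real \<Rightarrow> real \<Rightarrow> real" where
  "trapezoid a b z = ((pi - b) * G a z + (pi + a) * G b z) / (2 * pi - (b - a))"

text \<open>The height of \<open>trapezoid a b\<close> relative to that of the centred trapezoid of the same width.\<close>
definition skew :: "real \<Rightarrow> real \<Rightarrow> real" where
  "skew a b = 4 * (pi + a) * (pi - b) / (2 * pi - (b - a))\<^sup>2"

lemma trapezoid_eq:
  assumes "a \<le> b"
  shows "trapezoid a b z =
    (if z \<le> a then (pi - b) * (pi + z)
     else if z \<le> b then (pi + a) * (pi - b)
     else (pi + a) * (pi - z)) / (2 * pi - (b - a))"
proof -
  have "(pi - b) * G a z + (pi + a) * G b z =
    (if z \<le> a then (pi - b) * (pi + z)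
     else if z \<le> b then (pi + a) * (pi - b)
     else (pi + a) * (pi - z))"
    using assms by (auto simp: G_def field_simps)
  then show ?thesis by (simp add: trapezoid_def)
qed

lemma trapezoid_centred:
  assumes "0 \<le> r" "r < pi"
  shows "trapezoid (-r) r z = min (pi - r) (pi - \<bar>z\<bar>) / 2"
proof -
  have "(if z \<le> -r then (pi - r) * (pi + z)
      else if z \<le> r then (pi + -r) * (pi - r)
      else (pi + -r) * (pi - z))
      = (pi - r) * min (pi - r) (pi - \<bar>z\<bar>)"
    using assms by auto
  moreover have "2 * pi - (r - - r) = (pi - r) * 2" by simp
  ultimately have "trapezoid (-r) r z = (pi - r) * min (pi - r) (pi - \<bar>z\<bar>) / ((pi - r) * 2)"
    using assms by (simp only: trapezoid_eq)
  also have "\<dots> = min (pi - r) (pi - \<bar>z\<bar>) / 2"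
    by (rule nonzero_mult_divide_mult_cancel_left) (use assms in simp)
  finally show ?thesis .
qed

lemma trapezoid_upper:
  assumes "-pi \<le> a" "a \<le> b" "b \<le> pi" "z \<in> {-pi..pi}"
  shows "trapezoid a b z \<le> (pi - b) * (pi + z) / (2 * pi - (b - a))" (is ?left)
    and "trapezoid a b z \<le> (pi + a) * (pi - b) / (2 * pi - (b - a))" (is ?top)
    and "trapezoid a b z \<le> (pi + a) * (pi - z) / (2 * pi - (b - a))" (is ?right)
proof -
  consider "z \<le> a" | "a < z" "z \<le> b" | "b < z" by linarith
  then have "?left \<and> ?top \<and> ?right"
    using assms
    by cases (auto simp: trapezoid_eq mult.commute intro!: divide_right_mono mult_mono)
  then show ?left ?top ?right by blast+
qed

lemma skew_nonneg: "\<lbrakk>-pi \<le> a; b \<le> pi\<rbrakk> \<Longrightarrow> 0 \<le> skew a b"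
  by (simp add: skew_def)

lemma skew_denominator_minus_numerator: "(2 * pi - (b - a))\<^sup>2 - 4 * (pi + a) * (pi - b) = (a + b)\<^sup>2"
  by (simp add: power2_eq_square algebra_simps)

lemma skew_le_1: "skew a b \<le> 1"
proof -
  have "4 * (pi + a) * (pi - b) \<le> (2 * pi - (b - a))\<^sup>2"
    using skew_denominator_minus_numerator[of b a] zero_le_power2[of "a + b"] by linarith
  then show ?thesis by (cases "2 * pi - (b - a) = 0") (simp_all add: skew_def)
qed

lemma one_le_skew_imp_eq_minus: "1 \<le> skew a b \<Longrightarrow> a = - b"
proof -
  assume "1 \<le> skew a b"
  moreover from this have "(2 * pi - (b - a))\<^sup>2 \<noteq> 0" by (auto simp: skew_def)
  then have "0 < (2 * pi - (b - a))\<^sup>2" by simp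
  ultimately have "(2 * pi - (b - a))\<^sup>2 \<le> 4 * (pi + a) * (pi - b)"
    by (simp add: skew_def pos_le_divide_eq del: zero_less_power2)
  then have "(a + b)\<^sup>2 \<le> 0" using skew_denominator_minus_numerator[of b a] by linarith
  then show "a = - b" by simp
qed

lemma skew_centred: "r < pi \<Longrightarrow> skew (-r) r = 1"
  using skew_denominator_minus_numerator[of r "-r"] by (simp add: skew_def)

lemma min_trapezoid_le:
  assumes ab: "-pi \<le> a" "a \<le> b" "b \<le> pi" "b - a < 2 * pi" and xy: "-pi \<le> x" "x \<le> y" "y \<le> pi"
  shows "min (trapezoid a b x) (trapezoid a b y)
    \<le> skew a b * trapezoid (- ((b - a) / 2)) ((b - a) / 2) ((y - x) / 2)"
proof -
  define p q w where "p = pi + a" and "q = pi - b" and "w = 2 * pi - (b - a)"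
  define m where "m = min (trapezoid a b x) (trapezoid a b y)"
  have pqw: "0 \<le> p" "0 \<le> q" "0 < w" "w = p + q" using ab by (auto simp: p_def q_def w_def)
  have half: "(pi - s / 2) / 2 = (2 * pi - s) / 4" for s by (simp add: field_simps)
  have skew: "skew a b = 4 * p * q / (w * w)"
    by (simp add: skew_def p_def q_def w_def power2_eq_square)
  have m: "m \<le> q * (pi + x) / w" "m \<le> p * (pi - y) / w" "m \<le> p * q / w"
    using trapezoid_upper[OF ab(1-3), of x] trapezoid_upper[OF ab(1-3), of y] xy
    by (auto simp: m_def p_def q_def w_def min_le_iff_disj)
  have "m * w = p * m + q * m" by (simp add: pqw algebra_simps)
  also have "\<dots> \<le> p * (q * (pi + x) / w) + q * (p * (pi - y) / w)"
    using m pqw by (intro add_mono mult_left_mono)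
  also have "\<dots> = p * q * (2 * pi - (y - x)) / w"
    by (simp add: add_divide_distrib[symmetric] algebra_simps)
  finally have "m \<le> p * q * (2 * pi - (y - x)) / w / w" using pqw by (simp add: pos_le_divide_eq)
  also have "\<dots> = skew a b * ((pi - (y - x) / 2) / 2)"
    unfolding skew half by simp
  finally have slope: "m \<le> skew a b * ((pi - (y - x) / 2) / 2)" .
  note m(3)
  also have "p * q / w = skew a b * (w / 4)"
    using pqw(3) by (simp add: skew)
  also have "w / 4 = (pi - (b - a) / 2) / 2" unfolding half w_def by (rule refl)
  finally have top: "m \<le> skew a b * ((pi - (b - a) / 2) / 2)" .
  have "skew a b * trapezoid (- ((b - a) / 2)) ((b - a) / 2) ((y - x) / 2)
      = skew a b * min ((pi - (b - a) / 2) / 2) ((pi - (y - x) / 2) / 2)"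
    using ab xy by (subst trapezoid_centred) (auto simp: min_def)
  with slope top show ?thesis unfolding m_def[symmetric] by (metis min_def)
qed

lemma centred_majorant_trapezoid:
  assumes ab: "-pi \<le> a" "a \<le> b" "b \<le> pi"
  shows "centred_majorant pi (trapezoid a b)
    (\<lambda>z. skew a b * trapezoid (- ((b - a) / 2)) ((b - a) / 2) z)"
proof (cases "b - a < 2 * pi")
  case True
  have "trapezoid (- ((b - a) / 2)) ((b - a) / 2) y \<le> trapezoid (- ((b - a) / 2)) ((b - a) / 2) x"
    if "\<bar>x\<bar> \<le> \<bar>y\<bar>" for x y
    using True ab that by (auto simp: trapezoid_centred min_def)
  then show ?thesis
    using True ab by (auto simp: centred_majorant_def sym_decreasing_on_def
        intro: min_trapezoid_le mult_left_mono skew_nonneg)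
next
  case False
  then have "2 * pi - (b - a) = 0" using ab by linarith
  then show ?thesis
    by (simp add: centred_majorant_def sym_decreasing_on_def trapezoid_def skew_def)
qed

lemma trapezoid_nonneg:
  assumes "-pi \<le> a" "a \<le> b" "b \<le> pi" "z \<in> {-pi..pi}"
  shows "0 \<le> trapezoid a b z"
  using assms by (auto simp: trapezoid_eq)

lemma continuous_on_trapezoid: "continuous_on S (trapezoid a b)"
  unfolding trapezoid_def divide_inverse by (intro continuous_intros continuous_on_G)

section \<open>Solutions of the Dirichlet problem\<close>

lemma G_lipschitz:
  assumes y: "\<bar>y\<bar> \<le> pi"
  shows "\<bar>G x y - G x' y\<bar> \<le> \<bar>x - x'\<bar>"
proof -
  define e D d where "e = (x - x') * (y / (2 * pi))" and "D = \<bar>x - y\<bar> - \<bar>x' - y\<bar>" and "d = \<bar>x - x'\<bar>"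
  have "G x y - G x' y = - e - D / 2"
    by (simp add: e_def D_def G_def algebra_simps diff_divide_distrib)
  moreover have "\<bar>e\<bar> \<le> d * (1 / 2)"
    unfolding e_def d_def abs_mult using y by (intro mult_left_mono) (auto simp: field_simps)
  moreover have "\<bar>D\<bar> \<le> d"
    using abs_triangle_ineq3[of "x - y" "x' - y"] by (simp add: D_def d_def)
  ultimately show ?thesis unfolding d_def[symmetric] by linarith
qed

lemma concave_on_G: "concave_on UNIV (\<lambda>x. G x y)"
proof -
  have "concave_on UNIV (\<lambda>x. - (y / (2 * pi)) * x)"
    by (simp add: concave_on_iff algebra_simps add_divide_distrib)
  then have "concave_on UNIV (\<lambda>x. - (y / (2 * pi)) * x + pi / 2 - (1 / 2) * dist y x)"
    by (intro concave_on_diff concave_on_add convex_on_cmul convex_on_dist)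
      (auto simp: concave_on_const)
  moreover have "- (y / (2 * pi)) * x + pi / 2 - (1 / 2) * dist y x = G x y" for x
    by (simp add: G_def dist_real_def abs_minus_commute algebra_simps)
  ultimately show ?thesis by simp
qed

lemmas set_integrable_G_mult = set_integrable_continuous_mult[OF continuous_on_G]

lemma set_integrable_G_combination:
  assumes "set_integrable lebesgue {-pi..pi} g"
  shows "set_integrable lebesgue {-pi..pi} (\<lambda>y. (s * G a y + t * G b y) * g y)"
  by (intro set_integrable_continuous_mult assms continuous_intros continuous_on_G)

lemma set_integral_G_combination:
  assumes g: "set_integrable lebesgue {-pi..pi} g"
  shows "(LINT y:{-pi..pi}|lebesgue. (s * G a y + t * G b y) * g y) = s * u g a + t * u g b"
proof -
  have "set_integrable lebesgue {-pi..pi} (\<lambda>y. c * (G x y * g y))" for c x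
    by (intro set_integrable_mult_right set_integrable_G_mult g)
  then show ?thesis by (simp add: u_def distrib_right mult.assoc)
qed

lemma u_lipschitz:
  assumes g: "set_integrable lebesgue {-pi..pi} g"
  shows "(LINT y:{-pi..pi}|lebesgue. \<bar>g y\<bar>)-lipschitz_on UNIV (u g)"
proof (rule lipschitz_onI)
  fix x x'
  note diff = set_integrable_G_combination[OF g, of 1 x "-1" x']
  have "\<bar>u g x - u g x'\<bar> = \<bar>LINT y:{-pi..pi}|lebesgue. (1 * G x y + -1 * G x' y) * g y\<bar>"
    by (simp only: set_integral_G_combination[OF g])
  also have "\<dots> \<le> (LINT y:{-pi..pi}|lebesgue. \<bar>(1 * G x y + -1 * G x' y) * g y\<bar>)"
    using set_integral_norm_bound[OF diff] by simp
  also have "\<dots> \<le> (LINT y:{-pi..pi}|lebesgue. \<bar>x - x'\<bar> * \<bar>g y\<bar>)"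
  proof (rule set_integral_mono[OF set_integrable_abs[OF diff]])
    show "set_integrable lebesgue {-pi..pi} (\<lambda>y. \<bar>x - x'\<bar> * \<bar>g y\<bar>)"
      using set_integrable_abs[OF g] by simp
    show "\<bar>(1 * G x y + -1 * G x' y) * g y\<bar> \<le> \<bar>x - x'\<bar> * \<bar>g y\<bar>" if "y \<in> {-pi..pi}" for y
      using G_lipschitz[of y x x'] that by (auto simp: abs_mult intro: mult_right_mono)
  qed
  finally show "dist (u g x) (u g x') \<le> (LINT y:{-pi..pi}|lebesgue. \<bar>g y\<bar>) * dist x x'"
    by (simp add: dist_real_def mult.commute)
qed (rule set_lebesgue_integral_nonneg, simp)

lemma continuous_on_u: "set_integrable lebesgue {-pi..pi} g \<Longrightarrow> continuous_on S (u g)"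
  by (rule continuous_on_subset[OF lipschitz_on_continuous_on[OF u_lipschitz] subset_UNIV])

lemma borel_measurable_u:
  "set_integrable lebesgue {-pi..pi} g \<Longrightarrow> S \<in> sets lebesgue \<Longrightarrow> u g \<in> borel_measurable (lebesgue_on S)"
  by (intro continuous_imp_measurable_on_sets_lebesgue continuous_on_u)

lemma u_boundary: "u g pi = 0" "u g (- pi) = 0"
proof -
  have "indicator {-pi..pi} y *\<^sub>R (G pi y * g y) = 0"
    "indicator {-pi..pi} y *\<^sub>R (G (- pi) y * g y) = 0" for y
    by (auto simp: G_eq indicator_def)
  then show "u g pi = 0" "u g (- pi) = 0"
    by (simp_all only: u_def set_lebesgue_integral_def integral_zero)
qed

lemma u_even:
  assumes "\<And>y. g (- y) = g y"
  shows "u g (- x) = u g x"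
proof -
  have "u g x = (\<integral>y. indicator {-pi..pi} (0 + (-1) * y) *\<^sub>R
      (G x (0 + (-1) * y) * g (0 + (-1) * y)) \<partial>lebesgue)"
    unfolding u_def set_lebesgue_integral_def
    by (subst lebesgue_integral_real_affine[where c="-1" and t=0]) auto
  also have "\<dots> = u g (- x)"
    unfolding u_def set_lebesgue_integral_def
    by (intro Bochner_Integration.integral_cong)
      (auto simp: assms indicator_def G_def abs_minus_commute)
  finally show ?thesis by simp
qed

lemma u_cong_AE:
  assumes "set_integrable lebesgue {-pi..pi} g" "set_integrable lebesgue {-pi..pi} h"
    and "AE x\<in>{-pi..pi} in lebesgue. g x = h x"
  shows "u g x = u h x"
  unfolding u_def using assms
  by (intro set_lebesgue_integral_cong_AE_integrable set_integrable_G_mult)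
    (auto elim: eventually_mono)

lemma u_nonneg:
  assumes nonneg: "AE y\<in>{-pi..pi} in lebesgue. 0 \<le> g y" and x: "\<bar>x\<bar> \<le> pi"
  shows "0 \<le> u g x"
proof -
  have "x \<in> {-pi..pi}" using x by auto
  with nonneg show ?thesis
    unfolding u_def
    by (intro set_lebesgue_integral_nonneg)
      (auto elim!: eventually_mono intro!: mult_nonneg_nonneg G_nonneg)
qed

lemma concave_on_u:
  assumes g: "set_integrable lebesgue {-pi..pi} g" and nonneg: "AE y\<in>{-pi..pi} in lebesgue. 0 \<le> g y"
  shows "concave_on UNIV (u g)"
proof -
  have "s * u g a + t * u g b \<le> u g (s * a + t * b)" if st: "0 \<le> s" "0 \<le> t" "s + t = 1" for s t a b
  proof -
    have "s * G a y + t * G b y \<le> G (s * a + t * b) y" for y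
      using concave_on_G[of y] st unfolding concave_on_iff by simp
    then have "AE y\<in>{-pi..pi} in lebesgue. (s * G a y + t * G b y) * g y \<le> G (s * a + t * b) y * g y"
      using nonneg by (auto elim!: eventually_mono intro: mult_right_mono)
    then show ?thesis
      unfolding set_integral_G_combination[OF g, symmetric] unfolding u_def
      by (intro set_integral_mono_AE set_integrable_G_combination[OF g] set_integrable_G_mult[OF g])
  qed
  then show ?thesis by (simp add: concave_on_iff)
qed

lemma set_integral_trapezoid:
  assumes "set_integrable lebesgue {-pi..pi} g"
  shows "(LINT y:{-pi..pi}|lebesgue. trapezoid a b y * g y)
    = ((pi - b) * u g a + (pi + a) * u g b) / (2 * pi - (b - a))"
  using set_integral_G_combination[OF assms, of "pi - b" a "pi + a" b] by (simp add: trapezoid_def)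

lemma set_integral_centred_trapezoid:
  assumes g: "set_integrable lebesgue {-pi..pi} g" and even: "\<And>y. g (- y) = g y" and "r \<le> pi"
  shows "(LINT y:{-pi..pi}|lebesgue. trapezoid (-r) r y * g y) = u g r"
proof (cases "r = pi")
  case False
  have "(LINT y:{-pi..pi}|lebesgue. trapezoid (-r) r y * g y)
      = ((pi - r) * (2 * u g r)) / ((pi - r) * 2)"
    unfolding set_integral_trapezoid[OF g] u_even[where g=g, OF even]
    by (intro arg_cong2[where f="(/)"]) (simp_all add: algebra_simps)
  also have "\<dots> = u g r" using False by (subst nonzero_mult_divide_mult_cancel_left) simp_all
  finally show ?thesis .
qed (simp add: trapezoid_def u_boundary)

lemma AE_lborel_eq_zero_if_tail_integrals_eq_zero:
  fixes d :: "real \<Rightarrow> real"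
  assumes d: "integrable lborel d" and tail: "\<And>x. (LINT y:{x<..}|lborel. d y) = 0"
  shows "AE x in lborel. d x = 0"
proof -
  have set_int: "set_integrable lborel {x<..} k" if "integrable lborel k" for k :: "real \<Rightarrow> real" and x
    using that unfolding set_integrable_def by (intro integrable_mult_indicator) auto
  have tail_density: "emeasure (density lborel (\<lambda>y. ennreal (max 0 (k y)))) {x<..}
      = ennreal (LINT y:{x<..}|lborel. max 0 (k y))"
    if "integrable lborel k" for k :: "real \<Rightarrow> real" and x
    using that by (simp add: emeasure_density ennreal_set_lebesgue_integral set_int)
  have "(LINT y:{x<..}|lborel. max 0 (d y)) = (LINT y:{x<..}|lborel. max 0 (- d y))" for x
  proof -
    have "(LINT y:{x<..}|lborel. max 0 (d y)) - (LINT y:{x<..}|lborel. max 0 (- d y))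
        = (LINT y:{x<..}|lborel. max 0 (d y) - max 0 (- d y))"
      using d by (intro set_integral_diff(2)[symmetric] set_int) auto
    also have "(\<lambda>y. max 0 (d y) - max 0 (- d y)) = d" by auto
    finally show ?thesis using tail[of x] by simp
  qed
  then have "density lborel (\<lambda>y. ennreal (max 0 (d y))) = density lborel (\<lambda>y. ennreal (max 0 (- d y)))"
    by (intro measure_eqI_lessThan) (auto simp: tail_density d)
  then have "AE x in lborel. ennreal (max 0 (d x)) = ennreal (max 0 (- d x))"
    using d by (subst (asm) sigma_finite_measure.density_unique_iff[OF sigma_finite_lborel]) auto
  then show ?thesis by eventually_elim (auto simp: max_def split: if_splits)
qed

lemma AE_lebesgue_eq_zero_if_tail_integrals_eq_zero:
  fixes d :: "real \<Rightarrow> real"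
  assumes d: "integrable lebesgue d" and tail: "\<And>x. (LINT y:{x<..}|lebesgue. d y) = 0"
  shows "AE x in lebesgue. d x = 0"
proof -
  obtain d' where d': "d' \<in> borel_measurable lborel" and eq: "AE x in lborel. d x = d' x"
    using completion_ex_borel_measurable_real[OF borel_measurable_integrable[OF d]] by blast
  have "integrable lebesgue d'"
    using d' eq
    by (intro integrable_cong_AE_imp[OF d] AE_completion) (auto simp: measurable_completion)
  then have "integrable lborel d'" using d' by (simp add: integrable_completion)
  moreover have "(LINT y:{x<..}|lborel. d' y) = 0" for x
  proof -
    have "(LINT y:{x<..}|lborel. d' y) = (LINT y:{x<..}|lebesgue. d' y)"
      using d' by (simp add: set_lebesgue_integral_def integral_completion)
    also have "\<dots> = (LINT y:{x<..}|lebesgue. d y)"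
      using d d' eq by (intro set_lebesgue_integral_cong_AE)
        (auto simp: AE_completion_iff measurable_completion elim: eventually_mono)
    finally show ?thesis using tail by simp
  qed
  ultimately have "AE x in lborel. d' x = 0"
    by (rule AE_lborel_eq_zero_if_tail_integrals_eq_zero)
  with eq have "AE x in lborel. d x = 0" by eventually_elim simp
  then show ?thesis by (rule AE_completion)
qed

text \<open>The derivative of \<open>G\<close> in its first argument jumps at the second one, and its linear part
  cancels in the difference of the two quotients.\<close>
definition G_quotient :: "real \<Rightarrow> real \<Rightarrow> real \<Rightarrow> real" where
  "G_quotient h x y = ((G (x + h) y - G x y) - (G pi y - G (pi - h) y)) / h"

lemma abs_G_quotient_le:
  assumes "0 < h" "\<bar>y\<bar> \<le> pi"
  shows "\<bar>G_quotient h x y\<bar> \<le> 2"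
proof -
  have "\<bar>G (x + h) y - G x y\<bar> \<le> h" "\<bar>G pi y - G (pi - h) y\<bar> \<le> h"
    using G_lipschitz[of y "x + h" x] G_lipschitz[of y pi "pi - h"] assms by auto
  then have "\<bar>(G (x + h) y - G x y) - (G pi y - G (pi - h) y)\<bar> \<le> 2 * h" by linarith
  then show ?thesis using assms by (simp add: G_quotient_def pos_divide_le_eq)
qed

lemma G_quotient_eq_indicator:
  assumes "0 < h" "y \<le> pi - h" "y \<le> x \<or> x + h \<le> y"
  shows "G_quotient h x y = indicator {x<..} y"
proof -
  have "(G (x + h) y - G x y) - (G pi y - G (pi - h) y)
      = (\<bar>x - y\<bar> - \<bar>x + h - y\<bar> + (\<bar>pi - y\<bar> - \<bar>pi - h - y\<bar>)) / 2"
    by (simp add: G_def algebra_simps add_divide_distrib diff_divide_distrib)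
  also have "\<dots> = h * indicator {x<..} y"
    using assms by (auto simp: indicator_def)
  finally show ?thesis using assms by (simp add: G_quotient_def)
qed

lemma G_quotient_tendsto_indicator:
  assumes h: "h \<longlonglongrightarrow> 0" "\<And>n. 0 < h n" and y: "y < pi"
  shows "(\<lambda>n. G_quotient (h n) x y) \<longlonglongrightarrow> indicator {x<..} y"
proof (rule tendsto_eventually)
  have "\<forall>\<^sub>F n in sequentially. h n < (if x < y then min (y - x) (pi - y) else pi - y)"
    using y by (intro order_tendstoD(2)[OF h(1)]) auto
  then show "\<forall>\<^sub>F n in sequentially. G_quotient (h n) x y = indicator {x<..} y"
  proof eventually_elim
    case (elim n)
    then show ?case by (intro G_quotient_eq_indicator h(2)) (auto split: if_splits)
  qed
qed

lemma set_integrable_G_quotient_mult: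
  assumes "set_integrable lebesgue {-pi..pi} d"
  shows "set_integrable lebesgue {-pi..pi} (\<lambda>y. G_quotient h x y * d y)"
  using assms unfolding G_quotient_def divide_inverse
  by (intro set_integrable_continuous_mult continuous_intros continuous_on_G)

lemma set_integral_G_quotient_mult:
  assumes d: "set_integrable lebesgue {-pi..pi} d"
  shows "(LINT y:{-pi..pi}|lebesgue. G_quotient h x y * d y)
    = ((u d (x + h) - u d x) - (u d pi - u d (pi - h))) / h"
proof -
  have "G_quotient h x y * d y = (1 / h) * ((1 * G (x + h) y + -1 * G x y) * d y
      - (1 * G pi y + -1 * G (pi - h) y) * d y)" for y
    by (simp add: G_quotient_def algebra_simps add_divide_distrib diff_divide_distrib)
  then show ?thesis
    using set_integral_G_combination[OF d, of 1 _ "-1"]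
    by (simp only: set_integral_mult_right set_integral_diff set_integrable_G_combination[OF d]) simp
qed

lemma tail_integral_eq_zero_if_u_eq_zero:
  assumes d: "set_integrable lebesgue {-pi..pi} d"
    and zero: "\<And>x. x \<in> {-pi..pi} \<Longrightarrow> u d x = 0" and x: "-pi \<le> x" "x < pi"
  shows "(LINT y:{-pi..pi}|lebesgue. indicator {x<..} y * d y) = 0"
proof -
  define h where "h n = (pi - x) / real (Suc n)" for n
  have h: "0 < h n" "h n \<le> pi - x" for n
    using x divide_left_mono[of 1 "real (Suc n)" "pi - x"] by (auto simp: h_def)
  have h_lim: "h \<longlonglongrightarrow> 0"
    unfolding h_def by (rule LIMSEQ_Suc[OF lim_const_over_n])
  have quotient_zero: "(LINT y:{-pi..pi}|lebesgue. G_quotient (h n) x y * d y) = 0" for n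
    using zero x h[of n] by (simp add: set_integral_G_quotient_mult[OF d])
  have "(\<lambda>n. LINT y:{-pi..pi}|lebesgue. G_quotient (h n) x y * d y)
      \<longlonglongrightarrow> (LINT y:{-pi..pi}|lebesgue. indicator {x<..} y * d y)"
  proof (rule tendsto_set_integral_bounded_mult[OF d])
    show "set_integrable lebesgue {-pi..pi} (\<lambda>y. G_quotient (h n) x y * d y)" for n
      by (rule set_integrable_G_quotient_mult[OF d])
    show "set_integrable lebesgue {-pi..pi} (\<lambda>y. indicator {x<..} y * d y)"
      using integrable_mult_indicator[of "{x<..}" lebesgue "\<lambda>y. indicator {-pi..pi} y *\<^sub>R d y"] d
      by (simp add: set_integrable_def mult.left_commute)
    show "\<bar>G_quotient (h n) x y\<bar> \<le> 2" if "y \<in> {-pi..pi}" for n y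
      using that by (intro abs_G_quotient_le h(1)) auto
    have "AE y in lebesgue. y \<notin> {pi}" by (rule AE_lebesgue_notin_finite) simp
    then show "AE y\<in>{-pi..pi} in lebesgue. (\<lambda>n. G_quotient (h n) x y) \<longlonglongrightarrow> indicator {x<..} y"
      by eventually_elim (auto intro!: G_quotient_tendsto_indicator h_lim h(1))
  qed
  then show ?thesis by (simp add: quotient_zero LIMSEQ_const_iff)
qed

lemma u_eq_zero_imp_AE_eq_zero:
  assumes d: "set_integrable lebesgue {-pi..pi} d" and zero: "\<And>x. x \<in> {-pi..pi} \<Longrightarrow> u d x = 0"
  shows "AE x\<in>{-pi..pi} in lebesgue. d x = 0"
proof -
  define d' where "d' = (\<lambda>y. indicator {-pi..pi} y * d y)"
  have d': "integrable lebesgue d'" using d by (simp add: d'_def set_integrable_def)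
  have "(LINT y:{x<..}|lebesgue. d' y) = 0" for x
  proof (cases "x < pi")
    case True
    have "AE y in lebesgue. y \<notin> {-pi}" by (rule AE_lebesgue_notin_finite) simp
    then have "AE y in lebesgue. indicator {x<..} y *\<^sub>R d' y = indicator {max x (-pi)<..} y *\<^sub>R d' y"
      by eventually_elim (auto simp: d'_def indicator_def)
    then have "(LINT y:{x<..}|lebesgue. d' y) = (LINT y:{max x (-pi)<..}|lebesgue. d' y)"
      unfolding set_lebesgue_integral_def using borel_measurable_integrable[OF d']
      by (intro integral_cong_AE borel_measurable_scaleR borel_measurable_indicator) auto
    also have "\<dots> = (LINT y:{-pi..pi}|lebesgue. indicator {max x (-pi)<..} y * d y)"
      by (simp add: set_lebesgue_integral_def d'_def mult.left_commute)
    also have "\<dots> = 0"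
      using True by (intro tail_integral_eq_zero_if_u_eq_zero[OF d zero]) auto
    finally show ?thesis .
  next
    case False
    then have "indicator {x<..} y *\<^sub>R d' y = 0" for y by (auto simp: d'_def indicator_def)
    then show ?thesis by (simp only: set_lebesgue_integral_def integral_zero)
  qed
  with d' have "AE x in lebesgue. d' x = 0" by (rule AE_lebesgue_eq_zero_if_tail_integrals_eq_zero)
  then show ?thesis by eventually_elim (auto simp: d'_def indicator_eq_0_iff)
qed

lemma u_inject:
  assumes g: "set_integrable lebesgue {-pi..pi} g" and h: "set_integrable lebesgue {-pi..pi} h"
    and eq: "\<And>x. x \<in> {-pi..pi} \<Longrightarrow> u g x = u h x"
  shows "AE x\<in>{-pi..pi} in lebesgue. g x = h x"
proof -
  have "u (\<lambda>y. g y - h y) x = u g x - u h x" for x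
    by (simp add: u_def right_diff_distrib set_integral_diff set_integrable_G_mult g h)
  then have "AE x\<in>{-pi..pi} in lebesgue. g x - h x = 0"
    using g h eq by (intro u_eq_zero_imp_AE_eq_zero) auto
  then show ?thesis by eventually_elim simp
qed

section \<open>The symmetric decreasing rearrangement\<close>

definition distribution :: "(real \<Rightarrow> real) \<Rightarrow> real \<Rightarrow> real" where
  "distribution f s = measure lebesgue {x\<in>{-pi..pi}. s < f x}"

lemma distribution_nonneg: "0 \<le> distribution f s"
  by (simp add: distribution_def)

lemma sym_rearr_even: "sym_rearr f (- x) = sym_rearr f x"
  by (simp add: sym_rearr_def)

context
  fixes f :: "real \<Rightarrow> real"
  assumes f: "f \<in> borel_measurable (lebesgue_on {-pi..pi})"
begin

lemma superlevel_lmeasurable: "{x\<in>{-pi..pi}. s < f x} \<in> lmeasurable"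
  by (rule fmeasurableI2[OF lmeasurable_interval(1) _ superlevel_in_sets[OF f]]) auto

lemma emeasure_superlevel: "emeasure lebesgue {x\<in>{-pi..pi}. s < f x} = ennreal (distribution f s)"
  using superlevel_lmeasurable by (simp add: distribution_def emeasure_eq_measure2)

lemma distribution_le: "distribution f s \<le> 2 * pi"
proof -
  have "distribution f s \<le> measure lebesgue {-pi..pi}"
    unfolding distribution_def by (rule measure_mono_fmeasurable[OF _ superlevel_in_sets[OF f]]) auto
  then show ?thesis by simp
qed

lemma distribution_eq_cdf:
  "distribution f s = 2 * pi - cdf (distr (lebesgue_on {-pi..pi}) borel f) s"
proof -
  have "f -` {..s} \<inter> {-pi..pi} = {x\<in>{-pi..pi}. f x \<le> s}" by auto
  then have "cdf (distr (lebesgue_on {-pi..pi}) borel f) s = measure lebesgue {x\<in>{-pi..pi}. f x \<le> s}"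
    using f by (simp add: cdf_def measure_distr) (rule measure_restrict_space, auto)
  also have "{x\<in>{-pi..pi}. f x \<le> s} = {-pi..pi} - {x\<in>{-pi..pi}. s < f x}" by auto
  also have "measure lebesgue \<dots> = 2 * pi - distribution f s"
    unfolding distribution_def using superlevel_lmeasurable by (subst measurable_measure_Diff) auto
  finally show ?thesis by simp
qed

lemma right_continuous_mono_distribution:
  "right_continuous_mono (\<lambda>s. - distribution f s) (- (2 * pi)) 0"
proof -
  interpret finite_measure "lebesgue_on {-pi..pi}"
    by (rule finite_measure_lebesgue_on) simp
  interpret distr: finite_borel_measure "distr (lebesgue_on {-pi..pi}) borel f"
    by (intro finite_borel_measure.intro finite_measure_distr[OF f]
        finite_borel_measure_axioms.intro) simp
  have total: "measure (distr (lebesgue_on {-pi..pi}) borel f) UNIV = 2 * pi"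
    using f by (subst measure_distr) (auto simp: measure_restrict_space)
  show ?thesis
  proof
    show "continuous (at_right s) (\<lambda>s. - distribution f s)" for s
      unfolding distribution_eq_cdf by (intro continuous_intros distr.cdf_is_right_cont)
    show "mono (\<lambda>s. - distribution f s)"
      unfolding distribution_eq_cdf by (auto intro!: monoI distr.cdf_nondecreasing)
    show "((\<lambda>s. - distribution f s) \<longlongrightarrow> - (2 * pi)) at_bot"
      unfolding distribution_eq_cdf
      using tendsto_minus[OF tendsto_diff[OF tendsto_const[of "2 * pi"] distr.cdf_lim_at_bot]] by simp
    show "((\<lambda>s. - distribution f s) \<longlongrightarrow> 0) at_top"
      unfolding distribution_eq_cdf
      using tendsto_minus[OF tendsto_diff[OF tendsto_const[of "2 * pi"] distr.cdf_lim_at_top]]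
      by (simp add: total)
  qed
qed

lemma decr_rearr_le_iff:
  assumes "0 < t" "t < 2 * pi"
  shows "decr_rearr f t \<le> s \<longleftrightarrow> distribution f s \<le> t"
proof -
  have "decr_rearr f t = Inf {s. - t \<le> - distribution f s}"
    unfolding decr_rearr_def distribution_def neg_le_iff_le using assms by auto
  then show ?thesis
    using right_continuous_mono.pseudoinverse[OF right_continuous_mono_distribution, of "-t" s] assms
    by simp
qed

lemma less_sym_rearr_iff: "\<lbrakk>x \<noteq> 0; \<bar>x\<bar> < pi\<rbrakk> \<Longrightarrow> s < sym_rearr f x \<longleftrightarrow> 2 * \<bar>x\<bar> < distribution f s"
  using decr_rearr_le_iff[of "2 * \<bar>x\<bar>" s] by (auto simp: sym_rearr_def not_le[symmetric])

lemma borel_measurable_sym_rearr: "sym_rearr f \<in> borel_measurable (lebesgue_on {-pi..pi})"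
  unfolding borel_measurable_iff_greater
proof
  fix s
  define S N where "S = {x\<in>{-pi..pi}. s < sym_rearr f x}" and "N = {0, pi, -pi}"
  have "x \<in> S \<longleftrightarrow> \<bar>x\<bar> < pi \<and> 2 * \<bar>x\<bar> < distribution f s" if "x \<notin> N" for x
    using that less_sym_rearr_iff[of x s] by (auto simp: S_def N_def)
  then have "S = ({x. \<bar>x\<bar> < pi \<and> 2 * \<bar>x\<bar> < distribution f s} - N) \<union> (S \<inter> N)" by blast
  also have "\<dots> \<in> sets borel"
  proof (intro sets.Un sets.Diff)
    show "{x. \<bar>x\<bar> < pi \<and> 2 * \<bar>x\<bar> < distribution f s} \<in> sets borel" by measurable
    show "N \<in> sets borel" "S \<inter> N \<in> sets borel"
      by (intro borel_closed finite_imp_closed, simp add: N_def)+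
  qed
  finally show "{x\<in>space (lebesgue_on {-pi..pi}). s < sym_rearr f x} \<in> sets (lebesgue_on {-pi..pi})"
    by (auto simp: S_def sets_restrict_space_iff)
qed

lemma set_nn_integral_superlevel_sym_rearr:
  "(\<integral>\<^sup>+x\<in>{x\<in>{-pi..pi}. s < sym_rearr f x}. k x \<partial>lebesgue)
    = (\<integral>\<^sup>+x\<in>{-(distribution f s / 2)..distribution f s / 2}. k x \<partial>lebesgue)"
proof (rule nn_integral_cong_AE)
  have "AE x in lebesgue. x \<notin> {0, pi, -pi, distribution f s / 2, -(distribution f s / 2)}"
    by (rule AE_lebesgue_notin_finite) simp
  then show "AE x in lebesgue. k x * indicator {x\<in>{-pi..pi}. s < sym_rearr f x} x
      = k x * indicator {-(distribution f s / 2)..distribution f s / 2} x"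
  proof eventually_elim
    case (elim x)
    then have x: "x \<noteq> 0" "\<bar>x\<bar> \<noteq> pi" "2 * \<bar>x\<bar> \<noteq> distribution f s" by (auto simp: abs_if)
    then have "x \<in> {x\<in>{-pi..pi}. s < sym_rearr f x} \<longleftrightarrow> \<bar>x\<bar> < pi \<and> s < sym_rearr f x" by auto
    also have "\<dots> \<longleftrightarrow> 2 * \<bar>x\<bar> \<le> distribution f s"
      using less_sym_rearr_iff[of x s] x distribution_le[of s] by auto
    also have "\<dots> \<longleftrightarrow> x \<in> {-(distribution f s / 2)..distribution f s / 2}" by auto
    finally show ?case by (simp add: indicator_def)
  qed
qed

end

lemma distribution_sym_rearr:
  assumes f: "f \<in> borel_measurable (lebesgue_on {-pi..pi})"
  shows "distribution (sym_rearr f) s = distribution f s"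
proof -
  note sym_rearr = borel_measurable_sym_rearr[OF f]
  have "ennreal (distribution (sym_rearr f) s) = (\<integral>\<^sup>+x\<in>{x\<in>{-pi..pi}. s < sym_rearr f x}. 1 \<partial>lebesgue)"
    unfolding emeasure_superlevel[OF sym_rearr, symmetric] mult_1
    by (rule nn_integral_indicator[OF superlevel_in_sets[OF sym_rearr], symmetric]) simp
  also have "\<dots> = ennreal (distribution f s)"
    unfolding set_nn_integral_superlevel_sym_rearr[OF f] by (simp add: distribution_nonneg)
  finally show ?thesis by (simp add: distribution_nonneg)
qed

lemma set_nn_integral_sym_rearr:
  assumes f: "f \<in> borel_measurable (lebesgue_on {-pi..pi})"
  shows "(\<integral>\<^sup>+x\<in>{-pi..pi}. ennreal (sym_rearr f x) \<partial>lebesgue)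
    = (\<integral>\<^sup>+x\<in>{-pi..pi}. ennreal (f x) \<partial>lebesgue)"
proof -
  have I: "{-pi..pi} \<in> sets lebesgue" by simp
  note sym_rearr = borel_measurable_sym_rearr[OF f]
  show ?thesis
    unfolding lebesgue.set_nn_integral_layer_cake[OF f I]
      lebesgue.set_nn_integral_layer_cake[OF sym_rearr I]
      emeasure_superlevel[OF f] emeasure_superlevel[OF sym_rearr] distribution_sym_rearr[OF f] ..
qed

lemma nn_hardy_littlewood_centred_majorant:
  assumes f: "f \<in> borel_measurable (lebesgue_on {-pi..pi})"
    and UV: "centred_majorant pi U V"
    and U: "U \<in> borel_measurable lebesgue" and V: "V \<in> borel_measurable lebesgue"
  shows "(\<integral>\<^sup>+x\<in>{-pi..pi}. ennreal (U x) * ennreal (f x) \<partial>lebesgue)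
    \<le> (\<integral>\<^sup>+x\<in>{-pi..pi}. ennreal (V x) * ennreal (sym_rearr f x) \<partial>lebesgue)"
proof -
  have "(\<integral>\<^sup>+x\<in>{x\<in>{-pi..pi}. s < f x}. ennreal (U x) \<partial>lebesgue)
      \<le> (\<integral>\<^sup>+x\<in>{x\<in>{-pi..pi}. s < sym_rearr f x}. ennreal (V x) \<partial>lebesgue)" for s
    unfolding set_nn_integral_superlevel_sym_rearr[OF f]
  proof (rule set_nn_integral_le_centred_majorant[OF UV measurable_restrict_space1[OF U]
        superlevel_in_sets[OF f]])
    show "emeasure lebesgue {x\<in>{-pi..pi}. s < f x} \<le> ennreal (2 * (distribution f s / 2))"
      unfolding emeasure_superlevel[OF f] by simp
  qed (use distribution_le[OF f, of s] in auto)
  then show ?thesis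
    using U V by (simp add: lebesgue.set_nn_integral_mult_layer_cake f borel_measurable_sym_rearr[OF f]
        nn_integral_mono mult_right_mono)
qed

locale nonneg_integrable =
  fixes f :: "real \<Rightarrow> real"
  assumes integrable: "set_integrable lebesgue {-pi..pi} f"
    and nonneg: "AE x\<in>{-pi..pi} in lebesgue. 0 \<le> f x"
begin

lemma borel_measurable: "f \<in> borel_measurable (lebesgue_on {-pi..pi})"
  by (rule absolutely_integrable_imp_borel_measurable[OF integrable]) simp

lemma u_pos:
  assumes nonzero: "\<not> (AE x\<in>{-pi..pi} in lebesgue. f x = 0)" and x: "x \<in> {-pi<..<pi}"
  shows "0 < u f x"
proof (rule ccontr)
  assume "\<not> 0 < u f x"
  then have "(LINT y:{-pi..pi}|lebesgue. G x y * f y) = 0"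
    using u_nonneg[OF nonneg, of x] x by (auto simp: u_def abs_le_iff)
  moreover have "AE y\<in>{-pi..pi} in lebesgue. 0 \<le> G x y * f y"
    using nonneg by eventually_elim (use x in \<open>auto simp: G_nonneg\<close>)
  ultimately have "AE y\<in>{-pi..pi} in lebesgue. G x y * f y = 0"
    by (simp only: set_lebesgue_integral_eq_zero_iff[OF set_integrable_G_mult[OF integrable]])
  then have "AE y\<in>{-pi<..<pi} in lebesgue. f y = 0"
    by eventually_elim (use G_pos[OF x] in force)
  with nonzero show False unfolding AE_lebesgue_Icc_iff_Ioo by contradiction
qed

lemma sym_rearr_nonneg: "\<lbrakk>x \<noteq> 0; \<bar>x\<bar> < pi\<rbrakk> \<Longrightarrow> 0 \<le> sym_rearr f x"
proof (rule ccontr)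
  assume x: "x \<noteq> 0" "\<bar>x\<bar> < pi" and "\<not> 0 \<le> sym_rearr f x"
  then obtain s where s: "sym_rearr f x < s" "s < 0" using dense[of "sym_rearr f x" 0] by auto
  have "distribution f s = measure lebesgue {-pi..pi}"
    unfolding distribution_def
  proof (rule measure_eq_AE)
    show "AE y in lebesgue. y \<in> {x\<in>{-pi..pi}. s < f x} \<longleftrightarrow> y \<in> {-pi..pi}"
      using nonneg by eventually_elim (use s in auto)
  qed (use superlevel_in_sets[OF borel_measurable] in auto)
  then have "s < sym_rearr f x" using less_sym_rearr_iff[OF borel_measurable x] x by simp
  with s show False by simp
qed

lemma nonneg_integrable_sym_rearr: "nonneg_integrable (sym_rearr f)"
proof
  have "AE x in lebesgue. x \<notin> {0, pi, -pi}"
    by (rule AE_lebesgue_notin_finite) simp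
  then show nonneg': "AE x\<in>{-pi..pi} in lebesgue. 0 \<le> sym_rearr f x"
    by eventually_elim (auto intro!: sym_rearr_nonneg simp: abs_less_iff)
  show "set_integrable lebesgue {-pi..pi} (sym_rearr f)"
    unfolding set_integrable_def
  proof (rule integrableI_nonneg)
    show "(\<lambda>x. indicator {-pi..pi} x *\<^sub>R sym_rearr f x) \<in> borel_measurable lebesgue"
      using borel_measurable_sym_rearr[OF borel_measurable]
      by (subst (asm) borel_measurable_restrict_space_iff) auto
    show "AE x in lebesgue. 0 \<le> indicator {-pi..pi} x *\<^sub>R sym_rearr f x"
      using nonneg' by eventually_elim (simp add: indicator_def)
    have "(\<integral>\<^sup>+x. ennreal (indicator {-pi..pi} x *\<^sub>R sym_rearr f x) \<partial>lebesgue)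
        = (\<integral>\<^sup>+x\<in>{-pi..pi}. ennreal (sym_rearr f x) \<partial>lebesgue)"
      by (intro nn_integral_cong) (simp add: indicator_def)
    also have "\<dots> = ennreal (LINT x:{-pi..pi}|lebesgue. f x)"
      unfolding set_nn_integral_sym_rearr[OF borel_measurable]
      by (rule ennreal_set_lebesgue_integral[OF integrable nonneg, symmetric])
    finally show "(\<integral>\<^sup>+x. ennreal (indicator {-pi..pi} x *\<^sub>R sym_rearr f x) \<partial>lebesgue) < \<infinity>" by simp
  qed
qed

interpretation rearranged: nonneg_integrable "sym_rearr f"
  by (rule nonneg_integrable_sym_rearr)

lemma set_integral_sym_rearr:
  "(LINT x:{-pi..pi}|lebesgue. sym_rearr f x) = (LINT x:{-pi..pi}|lebesgue. f x)"
proof -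
  have "ennreal (LINT x:{-pi..pi}|lebesgue. sym_rearr f x) = ennreal (LINT x:{-pi..pi}|lebesgue. f x)"
    unfolding ennreal_set_lebesgue_integral[OF integrable nonneg]
      ennreal_set_lebesgue_integral[OF rearranged.integrable rearranged.nonneg]
    by (rule set_nn_integral_sym_rearr[OF borel_measurable])
  then show ?thesis
    by (simp only: ennreal_inj set_lebesgue_integral_nonneg[OF nonneg]
        set_lebesgue_integral_nonneg[OF rearranged.nonneg])
qed

lemma sym_rearr_eq_zero_iff:
  "(AE x\<in>{-pi..pi} in lebesgue. sym_rearr f x = 0) \<longleftrightarrow> (AE x\<in>{-pi..pi} in lebesgue. f x = 0)"
  unfolding set_lebesgue_integral_eq_zero_iff[OF integrable nonneg, symmetric]
    set_lebesgue_integral_eq_zero_iff[OF rearranged.integrable rearranged.nonneg, symmetric]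
    set_integral_sym_rearr ..

lemma hardy_littlewood_centred_majorant:
  assumes UV: "centred_majorant pi U V"
    and U: "U \<in> borel_measurable lebesgue" and V: "V \<in> borel_measurable lebesgue"
    and U_nonneg: "\<And>x. x \<in> {-pi..pi} \<Longrightarrow> 0 \<le> U x"
  shows "(LINT x:{-pi..pi}|lebesgue. U x * f x) \<le> (LINT x:{-pi..pi}|lebesgue. V x * sym_rearr f x)"
proof -
  have U_le: "U x \<le> V 0" if "x \<in> {-pi..pi}" for x
    by (rule centred_majorant_le_centre[OF UV]) (use that in auto)
  have V_le: "V x \<le> V 0" if "x \<in> {-pi..pi}" for x
    by (rule sym_decreasing_onD[OF centred_majorant_sym_decreasing[OF UV]]) (use that in auto)
  have V_nonneg: "0 \<le> V x" if "x \<in> {-pi..pi}" for x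
    by (rule centred_majorant_lower_bound[OF UV U_nonneg]) (use that in auto)
  have "ennreal (LINT x:{-pi..pi}|lebesgue. U x * f x)
      = (\<integral>\<^sup>+x\<in>{-pi..pi}. ennreal (U x) * ennreal (f x) \<partial>lebesgue)"
    by (rule ennreal_set_integral_bounded_mult[OF U U_nonneg U_le integrable nonneg]) auto
  also have "\<dots> \<le> (\<integral>\<^sup>+x\<in>{-pi..pi}. ennreal (V x) * ennreal (sym_rearr f x) \<partial>lebesgue)"
    by (rule nn_hardy_littlewood_centred_majorant[OF borel_measurable UV U V])
  also have "\<dots> = ennreal (LINT x:{-pi..pi}|lebesgue. V x * sym_rearr f x)"
    by (rule ennreal_set_integral_bounded_mult[symmetric, OF V V_nonneg V_le
          rearranged.integrable rearranged.nonneg]) auto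
  finally have "ennreal (LINT x:{-pi..pi}|lebesgue. U x * f x)
      \<le> ennreal (LINT x:{-pi..pi}|lebesgue. V x * sym_rearr f x)" .
  moreover have "0 \<le> (LINT x:{-pi..pi}|lebesgue. V x * sym_rearr f x)"
    using rearranged.nonneg V_nonneg
    by (intro set_lebesgue_integral_nonneg) (auto elim!: eventually_mono)
  ultimately show ?thesis by (simp add: ennreal_le_iff)
qed

section \<open>Comparison of the solutions\<close>

lemma sym_decreasing_on_u_sym_rearr: "sym_decreasing_on c (u (sym_rearr f))"
  by (rule sym_decreasing_on_if_concave_even[OF
        concave_on_u[OF rearranged.integrable rearranged.nonneg]])
    (rule u_even[where g="sym_rearr f", OF sym_rearr_even])

lemma weighted_mean_u_le:
  assumes ab: "-pi \<le> a" "a \<le> b" "b \<le> pi"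
  shows "((pi - b) * u f a + (pi + a) * u f b) / (2 * pi - (b - a))
    \<le> skew a b * u (sym_rearr f) ((b - a) / 2)"
proof -
  define r where "r = (b - a) / 2"
  have r: "0 \<le> r" "r \<le> pi" using ab by (auto simp: r_def)
  have "((pi - b) * u f a + (pi + a) * u f b) / (2 * pi - (b - a))
      = (LINT y:{-pi..pi}|lebesgue. trapezoid a b y * f y)"
    by (rule set_integral_trapezoid[OF integrable, symmetric])
  also have "\<dots> \<le> (LINT y:{-pi..pi}|lebesgue. (skew a b * trapezoid (- r) r y) * sym_rearr f y)"
  proof (rule hardy_littlewood_centred_majorant)
    show "centred_majorant pi (trapezoid a b) (\<lambda>y. skew a b * trapezoid (- r) r y)"
      unfolding r_def by (rule centred_majorant_trapezoid[OF ab])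
    have "trapezoid a b \<in> borel_measurable borel" for a b
      by (rule borel_measurable_continuous_onI[OF continuous_on_trapezoid])
    then show "trapezoid a b \<in> borel_measurable lebesgue"
      "(\<lambda>y. skew a b * trapezoid (- r) r y) \<in> borel_measurable lebesgue"
      by (auto intro: measurable_completion)
    show "0 \<le> trapezoid a b y" if "y \<in> {-pi..pi}" for y
      by (rule trapezoid_nonneg[OF ab that])
  qed
  also have "\<dots> = skew a b * (LINT y:{-pi..pi}|lebesgue. trapezoid (- r) r y * sym_rearr f y)"
    by (simp add: mult.assoc)
  also have "\<dots> = skew a b * u (sym_rearr f) r"
    by (simp only: set_integral_centred_trapezoid[where g="sym_rearr f",
          OF rearranged.integrable sym_rearr_even r(2)])
  finally show ?thesis unfolding r_def .
qed

lemma min_u_le_skew: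
  assumes ab: "-pi \<le> a" "a \<le> b" "b \<le> pi"
  shows "min (u f a) (u f b) \<le> skew a b * u (sym_rearr f) ((b - a) / 2)"
proof (cases "b - a < 2 * pi")
  case True
  define m where "m = min (u f a) (u f b)"
  have "m * (2 * pi - (b - a)) = (pi - b) * m + (pi + a) * m" by (simp add: algebra_simps)
  also have "\<dots> \<le> (pi - b) * u f a + (pi + a) * u f b"
    using ab by (intro add_mono mult_left_mono) (auto simp: m_def)
  finally have "m \<le> ((pi - b) * u f a + (pi + a) * u f b) / (2 * pi - (b - a))"
    using True by (simp add: pos_le_divide_eq)
  also have "\<dots> \<le> skew a b * u (sym_rearr f) ((b - a) / 2)"
    by (rule weighted_mean_u_le[OF ab])
  finally show ?thesis by (simp add: m_def)
next
  case False
  then have "a = -pi" "b = pi" using ab by auto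
  then show ?thesis by (simp add: u_boundary)
qed

lemma centred_majorant_u: "centred_majorant pi (u f) (u (sym_rearr f))"
  unfolding centred_majorant_def
proof (intro conjI sym_decreasing_on_u_sym_rearr allI impI)
  fix a b assume ab: "-pi \<le> a \<and> a \<le> b \<and> b \<le> pi"
  then have "min (u f a) (u f b) \<le> skew a b * u (sym_rearr f) ((b - a) / 2)"
    by (intro min_u_le_skew) auto
  also have "\<dots> \<le> 1 * u (sym_rearr f) ((b - a) / 2)"
    using ab by (intro mult_right_mono skew_le_1 u_nonneg rearranged.nonneg) auto
  finally show "min (u f a) (u f b) \<le> u (sym_rearr f) ((b - a) / 2)" by simp
qed

theorem integral_comp_u_le:
  fixes \<phi> :: "real \<Rightarrow> real"
  assumes "mono \<phi>"
  shows "(LINT x:{-pi..pi}|lebesgue. \<phi> (u f x)) \<le> (LINT x:{-pi..pi}|lebesgue. \<phi> (u (sym_rearr f) x))"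
  by (rule integral_comp_le_centred_majorant[OF assms centred_majorant_u
        borel_measurable_u[OF integrable] u_nonneg[OF nonneg]]) auto

theorem star_fun_u_le:
  assumes "t \<in> {0..2 * pi}"
  shows "star_fun (u f) t \<le> star_fun (u (sym_rearr f)) t"
  by (rule star_fun_le_centred_majorant[OF centred_majorant_u borel_measurable_u[OF integrable]
        u_nonneg[OF nonneg] assms]) auto

lemma average_u_le:
  assumes r: "0 \<le> r" "r < pi"
  shows "(u f (- r) + u f r) / 2 \<le> u (sym_rearr f) r"
proof -
  have "(u f (- r) + u f r) / 2 = ((pi - r) * (u f (- r) + u f r)) / ((pi - r) * 2)"
    using r by (subst nonzero_mult_divide_mult_cancel_left) simp_all
  also have "\<dots> = ((pi - r) * u f (- r) + (pi + - r) * u f r) / (2 * pi - (r - - r))"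
    by (intro arg_cong2[where f="(/)"]) (simp_all add: algebra_simps)
  also have "\<dots> \<le> skew (- r) r * u (sym_rearr f) ((r - - r) / 2)"
    by (rule weighted_mean_u_le) (use r in auto)
  also have "\<dots> = u (sym_rearr f) r"
    using r by (simp add: skew_centred)
  finally show ?thesis .
qed

lemma u_eq_if_attained:
  assumes x: "\<bar>x\<bar> < pi" and pos: "0 < u (sym_rearr f) x"
    and ab: "-pi \<le> a" "b \<le> pi" "2 * \<bar>x\<bar> \<le> b - a"
    and attained: "min (u f a) (u f b) = u (sym_rearr f) x"
  shows "u f x = u (sym_rearr f) x"
proof -
  let ?v = "u (sym_rearr f)"
  have "?v x \<le> skew a b * ?v ((b - a) / 2)"
    unfolding attained[symmetric] by (rule min_u_le_skew) (use ab in auto)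
  also have "\<dots> \<le> skew a b * ?v x"
    using ab by (intro mult_left_mono skew_nonneg
        sym_decreasing_onD[OF sym_decreasing_on_u_sym_rearr[of pi]]) auto
  finally have "a = - b" using pos by (intro one_le_skew_imp_eq_minus) simp
  have below: "?v x \<le> u f z" if "\<bar>z\<bar> = \<bar>x\<bar>" for z
  proof -
    have "concave_on {a..b} (u f)"
      using concave_on_u[OF integrable nonneg] by (simp add: concave_on_iff)
    then show ?thesis
      unfolding attained[symmetric] by (rule concave_on_ge_min) (use that ab \<open>a = - b\<close> in auto)
  qed
  have "?v \<bar>x\<bar> = ?v x"
    by (simp add: abs_if u_even[where g="sym_rearr f", OF sym_rearr_even])
  then have "u f (- \<bar>x\<bar>) + u f \<bar>x\<bar> \<le> 2 * ?v x"
    using average_u_le[of "\<bar>x\<bar>"] x by simp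
  moreover have "?v x \<le> u f (- \<bar>x\<bar>)" "?v x \<le> u f \<bar>x\<bar>" by (simp_all add: below)
  ultimately have "u f (- \<bar>x\<bar>) = ?v x" "u f \<bar>x\<bar> = ?v x" by linarith+
  then show ?thesis by (auto simp: abs_if split: if_splits)
qed

lemma u_eq_if_integral_comp_eq:
  fixes \<phi> :: "real \<Rightarrow> real"
  assumes nonzero: "\<not> (AE x\<in>{-pi..pi} in lebesgue. f x = 0)" and \<phi>: "strict_mono \<phi>"
    and eq: "(LINT x:{-pi..pi}|lebesgue. \<phi> (u f x))
      = (LINT x:{-pi..pi}|lebesgue. \<phi> (u (sym_rearr f) x))"
    and x: "x \<in> {-pi..pi}"
  shows "u f x = u (sym_rearr f) x"
proof -
  have cont: "continuous_on S (u f)" "continuous_on S (u (sym_rearr f))" for S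
    by (rule continuous_on_u[OF integrable] continuous_on_u[OF rearranged.integrable])+
  have "AE x\<in>{-pi..pi} in lebesgue. centred_hull pi (u f) x = u (sym_rearr f) x"
    by (rule centred_hull_eq_AE_if_integral_comp_eq[OF \<phi> cont(1) centred_majorant_u _ eq]) simp
  then have "AE x\<in>{-pi<..<pi} in lebesgue. u f x = u (sym_rearr f) x"
  proof eventually_elim
    case (elim x)
    show ?case
    proof
      assume x: "x \<in> {-pi<..<pi}"
      then have "\<bar>x\<bar> \<le> pi" by auto
      then obtain a b where "-pi \<le> a" "b \<le> pi" "2 * \<bar>x\<bar> \<le> b - a"
          and "centred_hull pi (u f) x = min (u f a) (u f b)"
        by (rule centred_hull_attained[OF cont(1)])
      moreover have "0 < u (sym_rearr f) x"
        using rearranged.u_pos[OF _ x] nonzero sym_rearr_eq_zero_iff by blast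
      ultimately show "u f x = u (sym_rearr f) x"
        using elim x by (intro u_eq_if_attained[of x a b]) auto
    qed
  qed
  then have "u f y = u (sym_rearr f) y" if "y \<in> {-pi<..<pi}" for y
    using continuous_AE_imp_eq[OF cont _ that] by blast
  moreover have "x = - pi \<or> x = pi \<or> x \<in> {-pi<..<pi}" using x by auto
  ultimately show ?thesis by (auto simp: u_boundary)
qed

theorem integral_comp_u_eq_iff:
  fixes \<phi> :: "real \<Rightarrow> real"
  assumes nonzero: "\<not> (AE x\<in>{-pi..pi} in lebesgue. f x = 0)" and \<phi>: "strict_mono \<phi>"
  shows "(LINT x:{-pi..pi}|lebesgue. \<phi> (u f x)) = (LINT x:{-pi..pi}|lebesgue. \<phi> (u (sym_rearr f) x))
    \<longleftrightarrow> (AE x\<in>{-pi<..<pi} in lebesgue. f x = sym_rearr f x)"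
proof
  assume "(LINT x:{-pi..pi}|lebesgue. \<phi> (u f x)) = (LINT x:{-pi..pi}|lebesgue. \<phi> (u (sym_rearr f) x))"
  then have "AE x\<in>{-pi..pi} in lebesgue. f x = sym_rearr f x"
    by (intro u_inject integrable rearranged.integrable u_eq_if_integral_comp_eq[OF nonzero \<phi>])
  then show "AE x\<in>{-pi<..<pi} in lebesgue. f x = sym_rearr f x"
    by (simp only: AE_lebesgue_Icc_iff_Ioo)
next
  assume "AE x\<in>{-pi<..<pi} in lebesgue. f x = sym_rearr f x"
  then have "u f x = u (sym_rearr f) x" for x
    by (intro u_cong_AE integrable rearranged.integrable) (simp only: AE_lebesgue_Icc_iff_Ioo)
  then show "(LINT x:{-pi..pi}|lebesgue. \<phi> (u f x))
      = (LINT x:{-pi..pi}|lebesgue. \<phi> (u (sym_rearr f) x))"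
    by simp
qed

end

theorem theorem5p7:
  fixes f :: "real \<Rightarrow> real"
  assumes f_int: "set_integrable lebesgue {-pi..pi} f"
    and f_nonneg: "AE x in lebesgue. x \<in> {-pi..pi} \<longrightarrow> 0 \<le> f x"
    and f_nonzero: "\<not> (AE x in lebesgue. x \<in> {-pi..pi} \<longrightarrow> f x = 0)"
  shows "(\<forall>\<phi> :: real \<Rightarrow> real. convex_on UNIV \<phi> \<and> mono \<phi> \<longrightarrow>
            (LINT x:{-pi..pi}|lebesgue. \<phi> (u f x))
              \<le> (LINT x:{-pi..pi}|lebesgue. \<phi> (u (sym_rearr f) x)))
       \<and> (\<forall>t \<in> {0..2*pi}. star_fun (u f) t \<le> star_fun (u (sym_rearr f)) t)
       \<and> (\<forall>\<phi> :: real \<Rightarrow> real. convex_on UNIV \<phi> \<and> strict_mono \<phi> \<longrightarrow>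
            ((LINT x:{-pi..pi}|lebesgue. \<phi> (u f x))
               = (LINT x:{-pi..pi}|lebesgue. \<phi> (u (sym_rearr f) x))
             \<longleftrightarrow> (AE x in lebesgue. x \<in> {-pi<..<pi} \<longrightarrow> f x = sym_rearr f x)))"
proof -
  interpret nonneg_integrable f
    using f_int f_nonneg by unfold_locales
  show ?thesis
    by (intro conjI allI ballI impI integral_comp_u_le star_fun_u_le
        integral_comp_u_eq_iff[OF f_nonzero]) auto
qed

end
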